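(* Let $F$ be a free group of finite rank. Then for a subgroup $H$ of $F$ the following conditions are equivalent: (a) $H$ is a retract of $F$; (b) $H$ is a verbally closed subgroup of $F$; (c) $H$ is an algebraically closed subgroup of $F$.
   Context: Let $X=\{x_1,x_2,\dots\}$ be a countably infinite set of variables and $F(X)$ the free group with basis $X$. Let $H$ be a subgroup of a group $G$. Retract: $H$ is a retract of $G$ if there is a homomorphism $\phi:G\to H$ (a retraction) which is the identity on $H$. Verbally closed: $H$ is verbally closed in $G$ if for every word $w=w(x_1,\dots,x_n)\in F(X)$ and every $h\in H$, the equation $w(x_1,\dots,x_n)=h$ has a solution in $G$ (i.e. $w(g_1,\dots,g_n)=h$ for some $g_1,\dots,g_n\in G$) if and only if it has a solution in $H$ (i.e. with $g_1,\dots,g_n\in H$). Algebraically closed: an equation with variables $x_1,\dots,x_n$ and constants from $H$ is an expression $E(x_1,\dots,x_n,H)=1$, where $E(x_1,\dots,x_n,H)$ is an element of the free product $F(X)\ast H$ involving only the variables $x_1,\dots,x_n$. It has a solution in $G$ if substituting some elements $g_i\in G$ for $x_i$ gives a true equality in $G$. $H$ is algebraically closed in $G$ if every finite system of equations in finitely many variables with constants from $H$ that has a solution in $G$ also has a solution in $H$. *)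

theory Defs
  imports "HOL-Algebra.Group"
begin

section \<open>Free groups\<close>

text \<open>
  The free group with basis \<open>X\<close> is realised on reduced words: the letter \<open>(x, True)\<close> stands for
  \<open>x\<close> and \<open>(x, False)\<close> for its formal inverse; no letter is followed by its formal inverse.
\<close>

type_synonym 'x letter = "'x \<times> bool"

definition flip_letter :: "'x letter \<Rightarrow> 'x letter"
  where "flip_letter l = (fst l, \<not> snd l)"

definition reduced_word :: "'x letter list \<Rightarrow> bool"
  where "reduced_word w \<longleftrightarrow> successively (\<lambda>k l. l \<noteq> flip_letter k) w"

fun push_letter :: "'x letter \<Rightarrow> 'x letter list \<Rightarrow> 'x letter list"
  where
    "push_letter l [] = [l]"
  | "push_letter l (k # w) = (if k = flip_letter l then w else l # k # w)"

definition free_group :: "'x set \<Rightarrow> 'x letter list monoid"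
  where "free_group X =
    \<lparr>carrier = {w. reduced_word w \<and> fst ` set w \<subseteq> X},
     monoid.mult = (\<lambda>u v. foldr push_letter u v),
     one = []\<rparr>"

definition eval_letter :: "('a, 'm) monoid_scheme \<Rightarrow> ('x \<Rightarrow> 'a) \<Rightarrow> 'x letter \<Rightarrow> 'a"
  where "eval_letter G g l = (if snd l then g (fst l) else inv\<^bsub>G\<^esub> g (fst l))"

text \<open>The value \<open>w(g)\<close> of a word \<open>w\<close> under the substitution \<open>g\<close> of its variables.\<close>

definition eval_word :: "('a, 'm) monoid_scheme \<Rightarrow> ('x \<Rightarrow> 'a) \<Rightarrow> 'x letter list \<Rightarrow> 'a"
  where "eval_word G g w = foldr (\<lambda>l a. eval_letter G g l \<otimes>\<^bsub>G\<^esub> a) w \<one>\<^bsub>G\<^esub>"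

definition free_basis :: "('a, 'm) monoid_scheme \<Rightarrow> 'a set \<Rightarrow> bool"
  where "free_basis G S \<longleftrightarrow>
    S \<subseteq> carrier G \<and> eval_word G (\<lambda>s. s) \<in> iso (free_group S) G"

definition free_group_of_finite_rank :: "('a, 'm) monoid_scheme \<Rightarrow> bool"
  where "free_group_of_finite_rank G \<longleftrightarrow> group G \<and> (\<exists>S. finite S \<and> free_basis G S)"

lemma flip_letter_simps [simp]:
  "flip_letter (flip_letter l) = l" "fst (flip_letter l) = fst l"
  "flip_letter l \<noteq> l" "l \<noteq> flip_letter l"
  by (auto simp: flip_letter_def prod_eq_iff)

lemma reduced_push_letter:
  "reduced_word w \<Longrightarrow> reduced_word (push_letter l w)"
  by (cases w; cases "tl w") (auto simp: reduced_word_def)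

lemma reduced_foldr_push:
  "reduced_word w \<Longrightarrow> reduced_word (foldr push_letter u w)"
  by (induction u) (auto simp: reduced_push_letter)

lemma letters_push_letter:
  "fst ` set (push_letter l w) \<subseteq> insert (fst l) (fst ` set w)"
  by (cases w) auto

lemma letters_foldr_push:
  "fst ` set (foldr push_letter u w) \<subseteq> fst ` set u \<union> fst ` set w"
proof (induction u)
  case (Cons l u)
  then show ?case using letters_push_letter[of l "foldr push_letter u w"]
    by (simp only: foldr.simps o_apply list.set image_insert) blast
qed simp

lemma push_flip_letter:
  "reduced_word w \<Longrightarrow> push_letter l (push_letter (flip_letter l) w) = w"
  by (cases w; cases "tl w") (auto simp: reduced_word_def)

lemma foldr_push_push:
  assumes "reduced_word w"
  shows "foldr push_letter (push_letter l v) w = push_letter l (foldr push_letter v w)"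
  using assms reduced_foldr_push[OF assms] by (cases v) (auto simp: push_flip_letter)

lemma foldr_push_assoc:
  "reduced_word w \<Longrightarrow>
    foldr push_letter (foldr push_letter u v) w = foldr push_letter u (foldr push_letter v w)"
  by (induction u) (auto simp: foldr_push_push)

lemma foldr_push_Nil:
  "reduced_word w \<Longrightarrow> foldr push_letter w [] = w"
proof (induction w)
  case (Cons l w)
  then show ?case by (cases w) (auto simp: reduced_word_def)
qed simp

lemma foldr_push_inverse:
  "reduced_word w \<Longrightarrow> foldr push_letter (map flip_letter (rev u)) (foldr push_letter u w) = w"
proof (induction u)
  case (Cons l u)
  have "push_letter (flip_letter l) (push_letter l (foldr push_letter u w)) = foldr push_letter u w"
    using push_flip_letter[of "foldr push_letter u w" "flip_letter l"]
      reduced_foldr_push[OF Cons.prems] by simp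
  then show ?case using Cons by simp
qed simp

lemma group_free_group: "group (free_group X)"
proof (rule groupI)
  fix u assume u: "u \<in> carrier (free_group X)"
  let ?v = "foldr push_letter (map flip_letter (rev u)) []"
  have red: "reduced_word []" by (simp add: reduced_word_def)
  have "?v \<in> carrier (free_group X)"
    using u subset_trans[OF letters_foldr_push[of "map flip_letter (rev u)" "[]"], of X]
      reduced_foldr_push[OF red, of "map flip_letter (rev u)"]
    by (simp add: free_group_def image_image)
  moreover have "?v \<otimes>\<^bsub>free_group X\<^esub> u = \<one>\<^bsub>free_group X\<^esub>"
    using u foldr_push_assoc[of u "map flip_letter (rev u)" "[]"]
      foldr_push_inverse[OF red, of u] foldr_push_Nil[of u]
    by (simp add: free_group_def)
  ultimately show "\<exists>v\<in>carrier (free_group X). v \<otimes>\<^bsub>free_group X\<^esub> u = \<one>\<^bsub>free_group X\<^esub>"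
    by blast
next
  fix u v assume "u \<in> carrier (free_group X)" "v \<in> carrier (free_group X)"
  then show "u \<otimes>\<^bsub>free_group X\<^esub> v \<in> carrier (free_group X)"
    using subset_trans[OF letters_foldr_push[of u v], of X]
    by (simp add: free_group_def reduced_foldr_push)
qed (auto simp: free_group_def foldr_push_assoc reduced_word_def)

lemma (in group) eval_letter_closed:
  "g (fst l) \<in> carrier G \<Longrightarrow> eval_letter G g l \<in> carrier G"
  by (simp add: eval_letter_def)

lemma (in group) eval_word_closed:
  "g ` fst ` set w \<subseteq> carrier G \<Longrightarrow> eval_word G g w \<in> carrier G"
  by (induction w) (auto simp: eval_word_def eval_letter_closed)

lemma (in group) eval_push_letter:
  assumes "g (fst l) \<in> carrier G" "g ` fst ` set w \<subseteq> carrier G"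
  shows "eval_word G g (push_letter l w) = eval_letter G g l \<otimes> eval_word G g w"
proof (cases w)
  case Nil
  then show ?thesis by (simp add: eval_word_def)
next
  case (Cons k v)
  have *: "eval_word G g v \<in> carrier G" "eval_letter G g l \<in> carrier G"
    using assms Cons by (auto intro!: eval_word_closed eval_letter_closed)
  have "eval_letter G g l \<otimes> eval_letter G g (flip_letter l) = \<one>"
    using assms(1) by (auto simp: eval_letter_def flip_letter_def)
  then have "eval_letter G g l \<otimes> (eval_letter G g (flip_letter l) \<otimes> eval_word G g v)
      = eval_word G g v"
    using * assms(1)
    by (simp add: m_assoc [symmetric] eval_letter_closed)
  then show ?thesis using Cons by (auto simp: eval_word_def)
qed

lemma (in group) eval_word_hom:
  assumes "g \<in> X \<rightarrow> carrier G"
  shows "eval_word G g \<in> hom (free_group X) G"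
proof (rule homI)
  fix u v assume "u \<in> carrier (free_group X)" "v \<in> carrier (free_group X)"
  then have "fst ` set u \<subseteq> X" "fst ` set v \<subseteq> X" by (auto simp: free_group_def)
  then have "eval_word G g (foldr push_letter u v) = eval_word G g u \<otimes> eval_word G g v"
  proof (induction u)
    case Nil
    then have "eval_word G g v \<in> carrier G" using assms by (intro eval_word_closed) auto
    then show ?case by (simp add: eval_word_def [of _ _ "[]"])
  next
    case (Cons l u)
    have "fst ` set (foldr push_letter u v) \<subseteq> X"
      using Cons.prems subset_trans[OF letters_foldr_push[of u v], of X] by simp
    moreover have "eval_word G g u \<in> carrier G" "eval_word G g v \<in> carrier G"
      "eval_letter G g l \<in> carrier G"
      using Cons.prems assms by (auto intro!: eval_word_closed eval_letter_closed)
    moreover have "eval_word G g (l # u) = eval_letter G g l \<otimes> eval_word G g u"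
      by (simp add: eval_word_def)
    ultimately show ?case
      using Cons assms eval_push_letter[of g l "foldr push_letter u v"]
      by (auto simp: m_assoc image_subset_iff Pi_iff)
  qed
  then show "eval_word G g (u \<otimes>\<^bsub>free_group X\<^esub> v) = eval_word G g u \<otimes> eval_word G g v"
    by (simp add: free_group_def)
qed (use assms in \<open>auto simp: free_group_def intro!: eval_word_closed\<close>)


section \<open>Free products\<close>

text \<open>
  Elements of the free product are in normal form: alternating sequences of nontrivial elements
  of the two factors.
\<close>

definition free_product_words ::
    "('a, 'm) monoid_scheme \<Rightarrow> ('b, 'n) monoid_scheme \<Rightarrow> ('a + 'b) list set"
  where "free_product_words A B =
    {w. set w \<subseteq> (carrier A - {\<one>\<^bsub>A\<^esub>}) <+> (carrier B - {\<one>\<^bsub>B\<^esub>}) \<and>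
        successively (\<lambda>k l. isl k \<noteq> isl l) w}"

text \<open>Left multiplication of a normal form by a nontrivial element of one of the factors.\<close>

definition push_factor ::
    "('a, 'm) monoid_scheme \<Rightarrow> ('b, 'n) monoid_scheme \<Rightarrow> 'a + 'b \<Rightarrow> ('a + 'b) list \<Rightarrow> ('a + 'b) list"
  where "push_factor A B l w =
    (case (l, w) of
      (Inl a, Inl c # v) \<Rightarrow> if a \<otimes>\<^bsub>A\<^esub> c = \<one>\<^bsub>A\<^esub> then v else Inl (a \<otimes>\<^bsub>A\<^esub> c) # v
    | (Inr b, Inr d # v) \<Rightarrow> if b \<otimes>\<^bsub>B\<^esub> d = \<one>\<^bsub>B\<^esub> then v else Inr (b \<otimes>\<^bsub>B\<^esub> d) # v
    | _ \<Rightarrow> l # w)"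

definition free_product ::
    "('a, 'm) monoid_scheme \<Rightarrow> ('b, 'n) monoid_scheme \<Rightarrow> ('a + 'b) list monoid"
  where "free_product A B =
    \<lparr>carrier = free_product_words A B,
     monoid.mult = (\<lambda>u v. foldr (push_factor A B) u v),
     one = []\<rparr>"

text \<open>The homomorphism on the free product induced by homomorphisms \<open>f\<close> and \<open>g\<close> of the factors.\<close>

definition eval_free_product ::
    "('c, 'm) monoid_scheme \<Rightarrow> ('a \<Rightarrow> 'c) \<Rightarrow> ('b \<Rightarrow> 'c) \<Rightarrow> ('a + 'b) list \<Rightarrow> 'c"
  where "eval_free_product G f g w = foldr (\<lambda>l c. case_sum f g l \<otimes>\<^bsub>G\<^esub> c) w \<one>\<^bsub>G\<^esub>"

lemma push_factor_simps [simp]: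
  "push_factor A B l [] = [l]"
  "push_factor A B (Inl a) (Inl c # w) =
    (if a \<otimes>\<^bsub>A\<^esub> c = \<one>\<^bsub>A\<^esub> then w else Inl (a \<otimes>\<^bsub>A\<^esub> c) # w)"
  "push_factor A B (Inr b) (Inr d # w) =
    (if b \<otimes>\<^bsub>B\<^esub> d = \<one>\<^bsub>B\<^esub> then w else Inr (b \<otimes>\<^bsub>B\<^esub> d) # w)"
  "push_factor A B (Inl a) (Inr d # w) = Inl a # Inr d # w"
  "push_factor A B (Inr b) (Inl c # w) = Inr b # Inl c # w"
  by (auto simp: push_factor_def split: sum.split)

lemma push_factor_cases:
  fixes l :: "'a + 'b" and w :: "('a + 'b) list"
  obtains (nil) "w = []"
  | (left) a c v where "l = Inl a" "w = Inl c # v"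
  | (right) b d v where "l = Inr b" "w = Inr d # v"
  | (left_right) a d v where "l = Inl a" "w = Inr d # v"
  | (right_left) b c v where "l = Inr b" "w = Inl c # v"
  by (cases w; cases l; cases "hd w") auto

context
  fixes A :: "('a, 'm) monoid_scheme" and B :: "('b, 'n) monoid_scheme"
  assumes A: "group A" and B: "group B"
begin

interpretation A: group A by (rule A)
interpretation B: group B by (rule B)

lemma push_factor_closed:
  "[l] \<in> free_product_words A B \<Longrightarrow> w \<in> free_product_words A B
    \<Longrightarrow> push_factor A B l w \<in> free_product_words A B"
  by (cases rule: push_factor_cases[where w = w and l = l]; cases "tl w")
    (auto simp: free_product_words_def)

lemma free_product_words_Cons:
  "l # w \<in> free_product_words A B
    \<Longrightarrow> [l] \<in> free_product_words A B \<and> w \<in> free_product_words A B"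
  by (cases w) (auto simp: free_product_words_def)

lemma foldr_push_factor_closed:
  "u \<in> free_product_words A B \<Longrightarrow> w \<in> free_product_words A B
    \<Longrightarrow> foldr (push_factor A B) u w \<in> free_product_words A B"
proof (induction u)
  case (Cons l u)
  then show ?case using free_product_words_Cons[of l u] by (simp add: push_factor_closed)
qed simp

lemma push_push_Inl:
  assumes "[Inl a] \<in> free_product_words A B" "[Inl c] \<in> free_product_words A B"
    and "w \<in> free_product_words A B"
  shows "push_factor A B (Inl a) (push_factor A B (Inl c) w) =
    (if a \<otimes>\<^bsub>A\<^esub> c = \<one>\<^bsub>A\<^esub> then w else push_factor A B (Inl (a \<otimes>\<^bsub>A\<^esub> c)) w)"
proof (cases "\<exists>d v. w = Inl d # v")
  case True
  then obtain d v where w: "w = Inl d # v" by blast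
  have c: "a \<in> carrier A" "c \<in> carrier A" "d \<in> carrier A" "a \<noteq> \<one>\<^bsub>A\<^esub>" "d \<noteq> \<one>\<^bsub>A\<^esub>"
    using assms w by (auto simp: free_product_words_def)
  have v: "push_factor A B (Inl e) v = Inl e # v" for e
    using assms(3) w by (cases rule: push_factor_cases[where w = v and l = "Inl e :: 'a + 'b"])
      (auto simp: free_product_words_def)
  have "a \<otimes>\<^bsub>A\<^esub> (c \<otimes>\<^bsub>A\<^esub> d) = (a \<otimes>\<^bsub>A\<^esub> c) \<otimes>\<^bsub>A\<^esub> d" using c by (simp add: A.m_assoc)
  moreover have "c \<otimes>\<^bsub>A\<^esub> d = \<one>\<^bsub>A\<^esub> \<Longrightarrow> (a \<otimes>\<^bsub>A\<^esub> c) \<otimes>\<^bsub>A\<^esub> d = a"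
    using c by (simp add: A.m_assoc)
  moreover have "a \<otimes>\<^bsub>A\<^esub> c = \<one>\<^bsub>A\<^esub> \<Longrightarrow> (a \<otimes>\<^bsub>A\<^esub> c) \<otimes>\<^bsub>A\<^esub> d = d"
    using c by simp
  ultimately show ?thesis using c by (auto simp: w v)
next
  case False
  then have "push_factor A B (Inl e) w = Inl e # w" for e
    by (cases rule: push_factor_cases[where w = w and l = "Inl e :: 'a + 'b"]) auto
  then show ?thesis by simp
qed

lemma push_push_Inr:
  assumes "[Inr a] \<in> free_product_words A B" "[Inr c] \<in> free_product_words A B"
    and "w \<in> free_product_words A B"
  shows "push_factor A B (Inr a) (push_factor A B (Inr c) w) =
    (if a \<otimes>\<^bsub>B\<^esub> c = \<one>\<^bsub>B\<^esub> then w else push_factor A B (Inr (a \<otimes>\<^bsub>B\<^esub> c)) w)"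
proof (cases "\<exists>d v. w = Inr d # v")
  case True
  then obtain d v where w: "w = Inr d # v" by blast
  have c: "a \<in> carrier B" "c \<in> carrier B" "d \<in> carrier B" "a \<noteq> \<one>\<^bsub>B\<^esub>" "d \<noteq> \<one>\<^bsub>B\<^esub>"
    using assms w by (auto simp: free_product_words_def)
  have v: "push_factor A B (Inr e) v = Inr e # v" for e
    using assms(3) w by (cases rule: push_factor_cases[where w = v and l = "Inr e :: 'a + 'b"])
      (auto simp: free_product_words_def)
  have "a \<otimes>\<^bsub>B\<^esub> (c \<otimes>\<^bsub>B\<^esub> d) = (a \<otimes>\<^bsub>B\<^esub> c) \<otimes>\<^bsub>B\<^esub> d" using c by (simp add: B.m_assoc)
  moreover have "c \<otimes>\<^bsub>B\<^esub> d = \<one>\<^bsub>B\<^esub> \<Longrightarrow> (a \<otimes>\<^bsub>B\<^esub> c) \<otimes>\<^bsub>B\<^esub> d = a"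
    using c by (simp add: B.m_assoc)
  moreover have "a \<otimes>\<^bsub>B\<^esub> c = \<one>\<^bsub>B\<^esub> \<Longrightarrow> (a \<otimes>\<^bsub>B\<^esub> c) \<otimes>\<^bsub>B\<^esub> d = d"
    using c by simp
  ultimately show ?thesis using c by (auto simp: w v)
next
  case False
  then have "push_factor A B (Inr e) w = Inr e # w" for e
    by (cases rule: push_factor_cases[where w = w and l = "Inr e :: 'a + 'b"]) auto
  then show ?thesis by simp
qed

lemma foldr_push_factor_push:
  assumes "[l] \<in> free_product_words A B" "v \<in> free_product_words A B"
    and "w \<in> free_product_words A B"
  shows "foldr (push_factor A B) (push_factor A B l v) w =
    push_factor A B l (foldr (push_factor A B) v w)"
  using assms
  by (cases rule: push_factor_cases[where w = v and l = l])
    (auto simp: push_push_Inl push_push_Inr foldr_push_factor_closed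
      dest: free_product_words_Cons)

lemma foldr_push_factor_assoc:
  "u \<in> free_product_words A B \<Longrightarrow> v \<in> free_product_words A B \<Longrightarrow> w \<in> free_product_words A B
    \<Longrightarrow> foldr (push_factor A B) (foldr (push_factor A B) u v) w =
      foldr (push_factor A B) u (foldr (push_factor A B) v w)"
proof (induction u)
  case (Cons l u)
  then show ?case using free_product_words_Cons[of l u]
    by (simp add: foldr_push_factor_push foldr_push_factor_closed)
qed simp

lemma free_product_left_inverse:
  "w \<in> free_product_words A B
    \<Longrightarrow> \<exists>v \<in> free_product_words A B. foldr (push_factor A B) v w = []"
proof (induction w)
  case Nil
  then show ?case by (intro bexI[of _ "[]"]) auto
next
  case (Cons l w)
  then have lw: "[l] \<in> free_product_words A B" "w \<in> free_product_words A B"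
    by (auto dest: free_product_words_Cons)
  with Cons obtain v where
    v: "v \<in> free_product_words A B" "foldr (push_factor A B) v w = []" by blast
  define k where "k = map_sum (m_inv A) (m_inv B) l"
  have k: "[k] \<in> free_product_words A B"
    using lw(1) by (cases l) (auto simp: k_def free_product_words_def)
  have kl: "push_factor A B k (l # w) = w"
    using lw(1) by (cases l) (auto simp: k_def free_product_words_def)
  have "foldr (push_factor A B) (foldr (push_factor A B) v [k]) (l # w) = []"
    using v(1) k Cons.prems by (subst foldr_push_factor_assoc) (auto simp: kl v(2))
  then show ?case using foldr_push_factor_closed[OF v(1) k] by blast
qed

lemma group_free_product: "group (free_product A B)"
proof (rule groupI)
  show "\<one>\<^bsub>free_product A B\<^esub> \<in> carrier (free_product A B)"
    by (simp add: free_product_def free_product_words_def)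
qed (auto simp: free_product_def foldr_push_factor_closed foldr_push_factor_assoc
      free_product_left_inverse)

lemma eval_free_product_hom:
  fixes G :: "('c, 'k) monoid_scheme"
  assumes G: "group G" and f: "f \<in> hom A G" and g: "g \<in> hom B G"
  shows "eval_free_product G f g \<in> hom (free_product A B) G"
proof -
  interpret G: group G by (rule G)
  interpret f: group_hom A G f by unfold_locales (rule f)
  interpret g: group_hom B G g by unfold_locales (rule g)
  have letter: "case_sum f g l \<in> carrier G" if "[l] \<in> free_product_words A B" for l
    using that by (auto simp: free_product_words_def split: sum.splits)
  have closed: "eval_free_product G f g w \<in> carrier G" if "w \<in> free_product_words A B" for w
    using that
  proof (induction w)
    case (Cons l w)
    then show ?case using free_product_words_Cons[of l w] letter[of l]
      by (simp add: eval_free_product_def)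
  qed (simp add: eval_free_product_def)
  have push: "eval_free_product G f g (push_factor A B l w) =
      case_sum f g l \<otimes>\<^bsub>G\<^esub> eval_free_product G f g w"
    if "[l] \<in> free_product_words A B" "w \<in> free_product_words A B" for l w
  proof (cases "\<exists>k v. w = k # v \<and> isl k = isl l")
    case True
    then obtain k v where w: "w = k # v" "isl k = isl l" by blast
    have v: "eval_free_product G f g v \<in> carrier G"
      using that(2) w free_product_words_Cons closed by blast
    have ev: "eval_free_product G f g (k # v) = case_sum f g k \<otimes>\<^bsub>G\<^esub> eval_free_product G f g v" for k v
      by (simp add: eval_free_product_def)
    show ?thesis
    proof (cases l)
      case (Inl a)
      then obtain c where k: "k = Inl c" using w(2) by (cases k) auto
      have ac: "a \<in> carrier A" "c \<in> carrier A"
        using that w k Inl by (auto simp: free_product_words_def)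
      then have "f a \<otimes>\<^bsub>G\<^esub> (f c \<otimes>\<^bsub>G\<^esub> eval_free_product G f g v) =
          f (a \<otimes>\<^bsub>A\<^esub> c) \<otimes>\<^bsub>G\<^esub> eval_free_product G f g v"
        using v by (simp add: G.m_assoc)
      then show ?thesis using Inl k w v ac
        by (auto simp: ev simp del: f.hom_mult)
    next
      case (Inr a)
      then obtain c where k: "k = Inr c" using w(2) by (cases k) auto
      have ac: "a \<in> carrier B" "c \<in> carrier B"
        using that w k Inr by (auto simp: free_product_words_def)
      then have "g a \<otimes>\<^bsub>G\<^esub> (g c \<otimes>\<^bsub>G\<^esub> eval_free_product G f g v) =
          g (a \<otimes>\<^bsub>B\<^esub> c) \<otimes>\<^bsub>G\<^esub> eval_free_product G f g v"
        using v by (simp add: G.m_assoc)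
      then show ?thesis using Inr k w v ac
        by (auto simp: ev simp del: g.hom_mult)
    qed
  next
    case False
    then have "push_factor A B l w = l # w"
      by (cases rule: push_factor_cases[where w = w and l = l]) auto
    then show ?thesis by (simp add: eval_free_product_def)
  qed
  have "eval_free_product G f g (foldr (push_factor A B) u w) =
      eval_free_product G f g u \<otimes>\<^bsub>G\<^esub> eval_free_product G f g w"
    if "u \<in> free_product_words A B" "w \<in> free_product_words A B" for u w
    using that(1)
  proof (induction u)
    case Nil
    then show ?case using closed[OF that(2)] by (simp add: eval_free_product_def [of _ _ _ "[]"])
  next
    case (Cons l u)
    then have lu: "[l] \<in> free_product_words A B" "u \<in> free_product_words A B"
      by (auto dest: free_product_words_Cons)
    have "eval_free_product G f g (l # u) = case_sum f g l \<otimes>\<^bsub>G\<^esub> eval_free_product G f g u"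
      by (simp add: eval_free_product_def)
    then show ?case
      using lu Cons.IH that(2) closed letter
      by (simp add: push foldr_push_factor_closed G.m_assoc)
  qed
  then show ?thesis using closed by (auto simp: hom_def free_product_def)
qed

end


section \<open>Retracts, verbally closed and algebraically closed subgroups\<close>

definition retract_subgroup :: "'a set \<Rightarrow> ('a, 'm) monoid_scheme \<Rightarrow> bool"
  where "retract_subgroup H G \<longleftrightarrow> (\<exists>\<phi> \<in> hom G (G\<lparr>carrier := H\<rparr>). \<forall>h\<in>H. \<phi> h = h)"

text \<open>
  The variables are indexed by natural numbers: words in \<open>x\<^sub>1, \<dots>, x\<^sub>n\<close> are the elements of
  \<open>free_group {1..n}\<close>, whose carrier is a subset of that of the free group on all variables.
  Likewise the normal forms over \<open>free_group {1..n}\<close> and \<open>H\<close> are those elements of the free product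
  of the full free group with \<open>H\<close> that involve only \<open>x\<^sub>1, \<dots>, x\<^sub>n\<close>.  For a subgroup \<open>H\<close>,
  evaluating at arguments in \<open>H\<close> gives the same value in \<open>G\<close> and in \<open>H\<close>.
\<close>

definition verbally_closed_subgroup :: "'a set \<Rightarrow> ('a, 'm) monoid_scheme \<Rightarrow> bool"
  where "verbally_closed_subgroup H G \<longleftrightarrow>
    (\<forall>n::nat. \<forall>w \<in> carrier (free_group {1..n}). \<forall>h\<in>H.
      (\<exists>g \<in> {1..n} \<rightarrow> carrier G. eval_word G g w = h) \<longleftrightarrow>
      (\<exists>g \<in> {1..n} \<rightarrow> H. eval_word G g w = h))"

definition group_equations :: "nat \<Rightarrow> 'a set \<Rightarrow> ('a, 'm) monoid_scheme \<Rightarrow> (nat letter list + 'a) list set"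
  where "group_equations n H G =
    carrier (free_product (free_group {1..n}) (G\<lparr>carrier := H\<rparr>))"

definition solves_equation ::
    "('a, 'm) monoid_scheme \<Rightarrow> (nat \<Rightarrow> 'a) \<Rightarrow> (nat letter list + 'a) list \<Rightarrow> bool"
  where "solves_equation G g E \<longleftrightarrow> eval_free_product G (eval_word G g) (\<lambda>h. h) E = \<one>\<^bsub>G\<^esub>"

definition algebraically_closed_subgroup :: "'a set \<Rightarrow> ('a, 'm) monoid_scheme \<Rightarrow> bool"
  where "algebraically_closed_subgroup H G \<longleftrightarrow>
    (\<forall>n. \<forall>\<E> \<subseteq> group_equations n H G. finite \<E> \<longrightarrow>
      (\<exists>g \<in> {1..n} \<rightarrow> carrier G. \<forall>E\<in>\<E>. solves_equation G g E) \<longrightarrow>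
      (\<exists>g \<in> {1..n} \<rightarrow> H. \<forall>E\<in>\<E>. solves_equation G g E))"

end

theory Submission
  imports Defs "HOL-Algebra.Coset" "HOL-Algebra.Bij"
begin

text \<open>
  Only the step from verbally closed to retract is hard.  Choose a basis \<open>h\<^sub>1, \<dots>, h\<^sub>m\<close> of \<open>H\<close> and let
  \<open>v = h\<^sub>1\<^sup>2 \<cdots> h\<^sub>m\<^sup>2\<close>.  As a word in the basis of \<open>F\<close>, \<open>v\<close> gives one equation that is solvable in \<open>F\<close>;
  a solution in \<open>H\<close> is a homomorphism \<open>\<phi> : F \<rightarrow> H\<close> with \<open>\<phi>(v) = v\<close>, and it suffices that \<open>\<phi>\<close> restricts to
  an automorphism of \<open>H\<close>.

  Evaluating \<open>v\<close> in the Heisenberg group modulo two shows that precomposition with \<open>\<phi>\<close> preserves the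
  standard bilinear form on \<open>Hom(H, \<int>/2)\<close>.  Hence the rank of \<open>H\<close> is at most that of \<open>F\<close>, the rank of
  \<open>\<phi>(H)\<close> is at least that of \<open>H\<close>, and \<open>\<phi>\<close> is injective on \<open>H\<close> because \<open>H\<close> is Hopfian.  The same form
  shows that \<open>v\<close> uses every element of every basis of \<open>\<phi>\<^sup>k(H)\<close>.  With the Schreier basis of a geodesic
  transversal, these elements are no longer than \<open>v\<close>, so there are only finitely many subgroups
  \<open>\<phi>\<^sup>k(H)\<close>; two of them agree, and injectivity gives \<open>\<phi>(H) = H\<close>.
\<close>

section \<open>Words and free families\<close>

lemma eval_word_Nil [simp]: "eval_word G g [] = \<one>\<^bsub>G\<^esub>"
  by (simp add: eval_word_def)

lemma eval_word_Cons [simp]: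
  "eval_word G g (l # w) = eval_letter G g l \<otimes>\<^bsub>G\<^esub> eval_word G g w"
  by (simp add: eval_word_def)

lemma eval_word_cong:
  assumes "\<And>x. x \<in> fst ` set w \<Longrightarrow> g x = g' x"
  shows "eval_word G g w = eval_word G g' w"
  using assms by (induction w) (auto simp: eval_letter_def)

lemma (in group_hom) hom_eval_word:
  assumes "g ` fst ` set w \<subseteq> carrier G"
  shows "h (eval_word G g w) = eval_word H (h \<circ> g) w"
  using assms
  by (induction w) (auto simp: eval_letter_def G.eval_word_closed)

lemma (in group) eval_word_subgroup:
  assumes "subgroup H G" "g ` fst ` set w \<subseteq> H"
  shows "eval_word (G\<lparr>carrier := H\<rparr>) g w = eval_word G g w"
  using assms by (induction w) (auto simp: eval_letter_def)

lemma (in group) eval_word_in_subgroup: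
  assumes "subgroup H G" "g ` fst ` set w \<subseteq> H"
  shows "eval_word G g w \<in> H"
proof -
  interpret H: group "G\<lparr>carrier := H\<rparr>" by (rule subgroup_imp_group[OF assms(1)])
  show ?thesis
    using H.eval_word_closed[of g w] assms by (simp add: eval_word_subgroup)
qed

lemma free_group_simps [simp]:
  "w \<in> carrier (free_group X) \<longleftrightarrow> reduced_word w \<and> fst ` set w \<subseteq> X"
  "u \<otimes>\<^bsub>free_group X\<^esub> v = foldr push_letter u v"
  "\<one>\<^bsub>free_group X\<^esub> = []"
  by (simp_all add: free_group_def)

text \<open>Bases are indexed families rather than sets, so that a homomorphism carries a basis
  along by mere composition and the index set may live in another type. Injectivity of
  \<open>g\<close> on \<open>I\<close> is forced by the isomorphism.\<close>

definition free_family :: "('a, 'm) monoid_scheme \<Rightarrow> 'i set \<Rightarrow> ('i \<Rightarrow> 'a) \<Rightarrow> bool"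
  where "free_family G I g \<longleftrightarrow> g \<in> I \<rightarrow> carrier G \<and> eval_word G g \<in> iso (free_group I) G"

lemma free_basis_iff_free_family: "free_basis G S \<longleftrightarrow> free_family G S (\<lambda>s. s)"
  by (auto simp: free_basis_def free_family_def)

lemma free_family_mem: "free_family G I g \<Longrightarrow> i \<in> I \<Longrightarrow> g i \<in> carrier G"
  by (auto simp: free_family_def)

lemma free_familyE:
  assumes "free_family G I g" "x \<in> carrier G"
  obtains w where "reduced_word w" "fst ` set w \<subseteq> I" "x = eval_word G g w"
proof -
  have "x \<in> eval_word G g ` carrier (free_group I)"
    using assms by (simp add: free_family_def iso_iff)
  then obtain w where "w \<in> carrier (free_group I)" "x = eval_word G g w" by blast
  then show thesis using that[of w] by simp
qed

lemma (in group) free_familyI: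
  assumes "g \<in> I \<rightarrow> carrier G"
    and "\<And>x. x \<in> carrier G \<Longrightarrow> \<exists>w \<in> carrier (free_group I). eval_word G g w = x"
    and "\<And>w. w \<in> carrier (free_group I) \<Longrightarrow> eval_word G g w = \<one> \<Longrightarrow> w = []"
  shows "free_family G I g"
proof -
  interpret e: group_hom "free_group I" G "eval_word G g"
    using eval_word_hom[OF assms(1)] group_free_group is_group
    by (simp add: group_hom_def group_hom_axioms_def)
  show ?thesis
    unfolding free_family_def e.iso_iff
  proof (intro conjI subsetI ballI impI)
    fix x assume "x \<in> carrier G"
    from assms(2)[OF this] show "x \<in> eval_word G g ` carrier (free_group I)" by blast
  next
    fix w assume "w \<in> carrier (free_group I)" "eval_word G g w = \<one>"
    from assms(3)[OF this] show "w = \<one>\<^bsub>free_group I\<^esub>" by simp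
  qed (rule assms(1))
qed

text \<open>Universal property of a basis: return to reduced words by the inverse isomorphism, then
  evaluate them at \<open>f\<close>.\<close>

lemma (in group) free_family_extend:
  assumes "free_family G I g" "group Q" "f \<in> I \<rightarrow> carrier Q"
  shows "\<exists>h \<in> hom G Q. \<forall>i \<in> I. h (g i) = f i"
proof -
  interpret I: group "free_group I" by (rule group_free_group)
  interpret Q: group Q by fact
  let ?e = "eval_word G g"
  have e: "?e \<in> iso (free_group I) G" using assms(1) by (simp add: free_family_def)
  let ?h = "eval_word Q f \<circ> inv_into (carrier (free_group I)) ?e"
  have "?h \<in> hom G Q"
    by (rule Group.hom_compose[OF iso_imp_homomorphism[OF I.iso_set_sym[OF e]]
          Q.eval_word_hom[OF assms(3)]])
  moreover have "?h (g i) = f i" if "i \<in> I" for i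
  proof -
    have "?e [(i, True)] = g i"
      using free_family_mem[OF assms(1) that] by (simp add: eval_letter_def)
    moreover have "[(i, True)] \<in> carrier (free_group I)"
      using that by (simp add: reduced_word_def)
    moreover have "inj_on ?e (carrier (free_group I))" using e by (simp add: iso_def bij_betw_def)
    ultimately have "inv_into (carrier (free_group I)) ?e (g i) = [(i, True)]"
      using inv_into_f_f[of ?e "carrier (free_group I)" "[(i, True)]"] by simp
    then show ?thesis using funcset_mem[OF assms(3) that] by (simp add: eval_letter_def)
  qed
  ultimately show ?thesis by blast
qed

lemma hom_eq_on_words:
  assumes "group G" "group Q" "h \<in> hom G Q" "h' \<in> hom G Q"
    and "g ` fst ` set w \<subseteq> carrier G"
    and "\<And>i. i \<in> fst ` set w \<Longrightarrow> h (g i) = h' (g i)"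
  shows "h (eval_word G g w) = h' (eval_word G g w)"
proof -
  interpret h: group_hom G Q h using assms(1-4) by (simp add: group_hom_def group_hom_axioms_def)
  interpret h': group_hom G Q h' using assms(1-4) by (simp add: group_hom_def group_hom_axioms_def)
  have "eval_word Q (h \<circ> g) w = eval_word Q (h' \<circ> g) w"
  proof (rule eval_word_cong)
    fix i assume "i \<in> fst ` set w"
    from assms(6)[OF this] show "(h \<circ> g) i = (h' \<circ> g) i" by simp
  qed
  then show ?thesis
    by (simp only: h.hom_eval_word[OF assms(5)] h'.hom_eval_word[OF assms(5)])
qed

lemma free_family_hom_eq:
  assumes "free_family G I g" "group G" "group Q" "h \<in> hom G Q" "h' \<in> hom G Q"
    and "\<And>i. i \<in> I \<Longrightarrow> h (g i) = h' (g i)" and "x \<in> carrier G"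
  shows "h x = h' x"
proof -
  obtain w where w: "fst ` set w \<subseteq> I" "x = eval_word G g w"
    using free_familyE[OF assms(1,7)] .
  show ?thesis unfolding w(2)
  proof (rule hom_eq_on_words[OF assms(2-5)])
    show "g ` fst ` set w \<subseteq> carrier G"
      using w(1) free_family_mem[OF assms(1)] by blast
    show "h (g i) = h' (g i)" if "i \<in> fst ` set w" for i
      using that w(1) assms(6) by blast
  qed
qed

lemma free_family_image:
  assumes "free_family G I g" "group G" "group M" "h \<in> hom G M" "inj_on h (carrier G)"
  shows "free_family (M\<lparr>carrier := h ` carrier G\<rparr>) I (h \<circ> g)"
proof -
  interpret h: group_hom G M h using assms by (simp add: group_hom_def group_hom_axioms_def)
  have sub: "subgroup (h ` carrier G) M" by (rule h.img_is_subgroup)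
  have "h \<in> iso G (M\<lparr>carrier := h ` carrier G\<rparr>)"
    using assms(4,5) unfolding iso_iff by (auto simp: hom_def)
  then have "h \<circ> eval_word G g \<in> iso (free_group I) (M\<lparr>carrier := h ` carrier G\<rparr>)"
    using assms(1) iso_set_trans unfolding free_family_def by blast
  moreover have "(h \<circ> eval_word G g) w = eval_word (M\<lparr>carrier := h ` carrier G\<rparr>) (h \<circ> g) w"
    if "w \<in> carrier (free_group I)" for w
  proof -
    have *: "g ` fst ` set w \<subseteq> carrier G"
      using that free_family_mem[OF assms(1)] by auto
    then have "(h \<circ> g) ` fst ` set w \<subseteq> h ` carrier G" by auto
    then show ?thesis
      using * h.hom_eval_word[of g w] h.H.eval_word_subgroup[OF sub, of "h \<circ> g" w]
      by (simp only: o_apply)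
  qed
  ultimately have "eval_word (M\<lparr>carrier := h ` carrier G\<rparr>) (h \<circ> g)
      \<in> iso (free_group I) (M\<lparr>carrier := h ` carrier G\<rparr>)"
    using group.iso_eq[OF group_free_group, of "h \<circ> eval_word G g" I
        "M\<lparr>carrier := h ` carrier G\<rparr>" "eval_word (M\<lparr>carrier := h ` carrier G\<rparr>) (h \<circ> g)"]
    by simp
  moreover have "h \<circ> g \<in> I \<rightarrow> h ` carrier G"
    using free_family_mem[OF assms(1)] by auto
  ultimately show ?thesis by (simp add: free_family_def)
qed

section \<open>Schreier generators of minimal length\<close>

text \<open>Each push either prepends its letter or cancels. Hence a product that is not a plain
  concatenation is strictly shorter, which decides length comparisons of products below.\<close>

lemma foldr_push_append_or_less:
  "foldr push_letter u v = u @ v \<or> length (foldr push_letter u v) < length u + length v"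
proof (induction u)
  case (Cons l u)
  have "push_letter l w = l # w \<or> length (push_letter l w) < Suc (length w)" for w
    by (cases w) auto
  from this[of "foldr push_letter u v"] Cons show ?case by auto
qed simp

lemma foldr_push_reduced:
  assumes "reduced_word (u @ v)"
  shows "foldr push_letter u v = u @ v"
proof -
  have "reduced_word v"
    using assms by (simp add: reduced_word_def successively_append_iff)
  then show ?thesis
    using foldr_push_Nil[OF assms] foldr_push_Nil[of v] by simp
qed

lemma reduced_singleton [simp]: "reduced_word [l]"
  by (simp add: reduced_word_def)

lemma reduced_Nil [simp]: "reduced_word []"
  by (simp add: reduced_word_def)

lemma inv_free_group:
  assumes "w \<in> carrier (free_group X)"
  shows "inv\<^bsub>free_group X\<^esub> w = map flip_letter (rev w)"
proof -
  interpret group "free_group X" by (rule group_free_group)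
  have red: "successively (\<lambda>k l. k \<noteq> flip_letter l) w"
  proof (rule successively_mono)
    show "successively (\<lambda>k l. l \<noteq> flip_letter k) w"
      using assms by (simp add: reduced_word_def)
    show "k \<noteq> flip_letter l" if "l \<noteq> flip_letter k" for k l :: "'a letter"
      using that by (metis flip_letter_simps(1))
  qed
  have "reduced_word (map flip_letter (rev w))"
    unfolding reduced_word_def successively_map successively_rev
    by (rule successively_mono[OF red]) (metis flip_letter_simps(1))
  then have "map flip_letter (rev w) \<in> carrier (free_group X)"
    using assms by (auto simp: image_image)
  moreover have "map flip_letter (rev w) \<otimes>\<^bsub>free_group X\<^esub> w = \<one>\<^bsub>free_group X\<^esub>"
    using foldr_push_inverse[of "[]" w] foldr_push_Nil[of w] assms by simp
  ultimately show ?thesis using assms by (simp add: inv_equality)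
qed

text \<open>Recovers a word from its evaluation at the one-letter words; this is how a left inverse
  of an evaluation map will be recognised.\<close>

lemma eval_word_generators:
  assumes "w \<in> carrier (free_group B)"
  shows "eval_word (free_group B) (\<lambda>b. [(b, True)]) w = w"
  using assms
proof (induction w)
  case (Cons l w)
  have B: "fst l \<in> B" and w: "w \<in> carrier (free_group B)"
    using Cons.prems by (auto simp: reduced_word_def successively_Cons)
  have "eval_letter (free_group B) (\<lambda>b. [(b, True)]) l = [l]"
    using B inv_free_group[of "[(fst l, True)]" B]
    by (cases l) (auto simp: eval_letter_def flip_letter_def)
  moreover have "foldr push_letter [l] w = [l] @ w"
    using Cons.prems by (intro foldr_push_reduced) simp
  ultimately show ?case using Cons.IH[OF w] by simp
qed simp

section \<open>Minimal coset representatives and Schreier generators\<close>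

locale schreier =
  fixes X :: "'x set" and K :: "'x letter list set" and r :: "'x letter rel"
  assumes K: "subgroup K (free_group X)" and wo: "well_order_on UNIV r"
begin

abbreviation F where "F \<equiv> free_group X"
text \<open>Words are compared by length first and then lexicographically. Well-foundedness and
  totality give every coset a unique least element, and the priority of length makes that element
  geodesic.\<close>

abbreviation R where "R \<equiv> lenlex (r - Id)"

sublocale group F by (rule group_free_group)

lemma K_sub: "k \<in> K \<Longrightarrow> k \<in> carrier F"
  using subgroup.mem_carrier[OF K] .

lemma wf_R: "wf R"
  using wo by (auto simp: well_order_on_def)

lemma R_cases: "u = v \<or> (u, v) \<in> R \<or> (v, u) \<in> R"
proof -
  have "total (r - Id)"
    using wo by (auto simp: well_order_on_def linear_order_on_def total_on_def)
  from total_lenlex[OF this] show ?thesis by (auto simp: total_on_def)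
qed

definition rep :: "'x letter list \<Rightarrow> 'x letter list"
  where "rep u = (SOME t. t \<in> K #>\<^bsub>F\<^esub> u \<and> (\<forall>s \<in> K #>\<^bsub>F\<^esub> u. (s, t) \<notin> R))"

lemma rep:
  assumes "u \<in> carrier F"
  shows "rep u \<in> K #>\<^bsub>F\<^esub> u" and "s \<in> K #>\<^bsub>F\<^esub> u \<Longrightarrow> (s, rep u) \<notin> R"
proof -
  have "\<exists>t. t \<in> K #>\<^bsub>F\<^esub> u \<and> (\<forall>s \<in> K #>\<^bsub>F\<^esub> u. (s, t) \<notin> R)"
    using wfE_min[OF wf_R rcos_self[OF assms K]] by metis
  then have "rep u \<in> K #>\<^bsub>F\<^esub> u \<and> (\<forall>s \<in> K #>\<^bsub>F\<^esub> u. (s, rep u) \<notin> R)"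
    unfolding rep_def by (rule someI_ex)
  then show "rep u \<in> K #>\<^bsub>F\<^esub> u" "s \<in> K #>\<^bsub>F\<^esub> u \<Longrightarrow> (s, rep u) \<notin> R" by auto
qed

lemma coset_rep: "u \<in> carrier F \<Longrightarrow> K #>\<^bsub>F\<^esub> rep u = K #>\<^bsub>F\<^esub> u"
  using repr_independence[OF rep(1) _ K] by simp

lemma rep_closed: "u \<in> carrier F \<Longrightarrow> rep u \<in> carrier F"
  using rep(1) r_coset_subset_G[of K u] subgroup.subset[OF K] by blast

lemma rep_eqI:
  assumes "u \<in> carrier F" "t \<in> K #>\<^bsub>F\<^esub> u" "\<And>s. s \<in> K #>\<^bsub>F\<^esub> u \<Longrightarrow> (s, t) \<notin> R"
  shows "rep u = t"
  using R_cases[of "rep u" t] rep[OF assms(1)] assms(2,3) by blast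

lemma rep_cong: "K #>\<^bsub>F\<^esub> u = K #>\<^bsub>F\<^esub> v \<Longrightarrow> rep u = rep v"
  by (simp add: rep_def)

lemma coset_translate: "k \<in> K \<Longrightarrow> u \<in> carrier F \<Longrightarrow> K #>\<^bsub>F\<^esub> (k \<otimes>\<^bsub>F\<^esub> u) = K #>\<^bsub>F\<^esub> u"
  using coset_mult_assoc[of K k u] coset_join2[of k K] K K_sub subgroup.subset[OF K]
  by metis

lemma rep_translate: "k \<in> K \<Longrightarrow> u \<in> carrier F \<Longrightarrow> rep (k \<otimes>\<^bsub>F\<^esub> u) = rep u"
  by (rule rep_cong[OF coset_translate])

lemma rep_rep: "u \<in> carrier F \<Longrightarrow> rep (rep u) = rep u"
  by (rule rep_cong[OF coset_rep])

lemma rep_mult_rep: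
  "u \<in> carrier F \<Longrightarrow> v \<in> carrier F \<Longrightarrow> rep (rep u \<otimes>\<^bsub>F\<^esub> v) = rep (u \<otimes>\<^bsub>F\<^esub> v)"
  using coset_mult_assoc[of K "rep u" v] coset_mult_assoc[of K u v] coset_rep[of u]
    rep_closed subgroup.subset[OF K]
  by (metis rep_cong)

lemma length_rep_le:
  assumes "u \<in> carrier F" "s \<in> K #>\<^bsub>F\<^esub> u"
  shows "length (rep u) \<le> length s"
  using rep(2)[OF assms] by (auto simp: lenlex_conv)

lemma rep_in_K:
  assumes "k \<in> K"
  shows "rep k = []"
proof (rule rep_eqI)
  show "k \<in> carrier F" using assms by (rule K_sub)
  show "[] \<in> K #>\<^bsub>F\<^esub> k"
    using coset_join2[OF K_sub[OF assms] K assms] subgroup.one_closed[OF K] by simp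
qed (simp add: lenlex_conv)

text \<open>The Schreier property: prefixes of representatives are representatives. If some
  \<open>q\<close> in the coset of \<open>p\<close> were smaller than \<open>p\<close>, then
  \<open>q\<close> times \<open>[l]\<close> would lie in the coset of \<open>p @ [l]\<close> and be
  smaller than \<open>p @ [l]\<close>: by appending to both words if nothing cancels, and by length
  otherwise.\<close>

lemma rep_butlast:
  assumes t: "p @ [l] \<in> carrier F" "rep (p @ [l]) = p @ [l]"
  shows "p \<in> carrier F" "rep p = p"
proof -
  have l: "[l] \<in> carrier F" using t(1) by auto
  show p: "p \<in> carrier F"
    using t(1) by (auto simp: reduced_word_def successively_append_iff)
  define q where "q = rep p"
  have q: "q \<in> carrier F" unfolding q_def by (rule rep_closed[OF p])
  have pl: "p \<otimes>\<^bsub>F\<^esub> [l] = p @ [l]" using t(1) foldr_push_reduced[of p "[l]"] by simp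
  have "q \<otimes>\<^bsub>F\<^esub> [l] \<in> K #>\<^bsub>F\<^esub> (p @ [l])"
  proof -
    have "K #>\<^bsub>F\<^esub> (q \<otimes>\<^bsub>F\<^esub> [l]) = K #>\<^bsub>F\<^esub> (p @ [l])"
      using coset_mult_assoc[of K q "[l]"] coset_mult_assoc[of K p "[l]"] coset_rep[OF p]
        subgroup.subset[OF K] p q l unfolding q_def pl by metis
    moreover have "q \<otimes>\<^bsub>F\<^esub> [l] \<in> K #>\<^bsub>F\<^esub> (q \<otimes>\<^bsub>F\<^esub> [l])"
      by (rule rcos_self[OF m_closed[OF q l] K])
    ultimately show ?thesis by simp
  qed
  then have min: "(q \<otimes>\<^bsub>F\<^esub> [l], p @ [l]) \<notin> R"
    using rep(2)[OF t(1)] t(2) by metis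
  have "(q, p) \<notin> R"
  proof
    assume qp: "(q, p) \<in> R"
    then have "length q \<le> length p" by (rule lenlex_length)
    then have "foldr push_letter q [l] \<noteq> q @ [l] \<Longrightarrow> (foldr push_letter q [l], p @ [l]) \<in> R"
      using foldr_push_append_or_less[of q "[l]"] by (auto simp: lenlex_conv)
    moreover have "(q @ [l], p @ [l]) \<in> R"
      using lenlex_append1[OF qp, of "[l]" "[l]"] by simp
    ultimately show False using min by (cases "foldr push_letter q [l] = q @ [l]") simp_all
  qed
  moreover have "(p, q) \<notin> R"
    unfolding q_def using rep(2)[OF p] rcos_self[OF p K] .
  ultimately show "rep p = p" using R_cases[of p q] by (auto simp: q_def)
qed

text \<open>The loop in the coset graph of \<open>K\<close> that runs along the tree to the coset of
  \<open>u\<close>, crosses the edge labelled \<open>x\<close>, and returns along the tree.\<close>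

definition gen :: "'x letter list \<Rightarrow> 'x \<Rightarrow> 'x letter list"
  where "gen u x = rep u \<otimes>\<^bsub>F\<^esub> [(x, True)] \<otimes>\<^bsub>F\<^esub> inv\<^bsub>F\<^esub> rep (u \<otimes>\<^bsub>F\<^esub> [(x, True)])"

definition gens :: "'x letter list set"
  where "gens = {gen u x | u x. u \<in> carrier F \<and> x \<in> X} - {[]}"

lemma mult_rep_in_K:
  assumes "u \<in> carrier F" "v \<in> carrier F" "K #>\<^bsub>F\<^esub> u = K #>\<^bsub>F\<^esub> v"
  shows "u \<otimes>\<^bsub>F\<^esub> inv\<^bsub>F\<^esub> v \<in> K"
proof -
  have "u \<in> K #>\<^bsub>F\<^esub> v" using rcos_self[OF assms(1) K] assms(3) by simp
  then obtain k where k: "k \<in> K" "u = k \<otimes>\<^bsub>F\<^esub> v" unfolding r_coset_def by auto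
  then have "u \<otimes>\<^bsub>F\<^esub> inv\<^bsub>F\<^esub> v = k"
    using assms(2) K_sub[OF k(1)] by (metis inv_solve_right m_closed)
  then show ?thesis using k(1) by simp
qed

lemma step_in_K:
  assumes "u \<in> carrier F" "fst l \<in> X"
  shows "rep u \<otimes>\<^bsub>F\<^esub> [l] \<otimes>\<^bsub>F\<^esub> inv\<^bsub>F\<^esub> rep (u \<otimes>\<^bsub>F\<^esub> [l]) \<in> K"
proof (rule mult_rep_in_K)
  have l: "[l] \<in> carrier F" using assms(2) by simp
  show "rep u \<otimes>\<^bsub>F\<^esub> [l] \<in> carrier F" "rep (u \<otimes>\<^bsub>F\<^esub> [l]) \<in> carrier F"
    using assms(1) l by (simp_all only: m_closed rep_closed)
  have "K #>\<^bsub>F\<^esub> (rep u \<otimes>\<^bsub>F\<^esub> [l]) = K #>\<^bsub>F\<^esub> (u \<otimes>\<^bsub>F\<^esub> [l])"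
    using coset_mult_assoc[of K "rep u" "[l]"] coset_mult_assoc[of K u "[l]"] coset_rep[of u]
      rep_closed[of u] subgroup.subset[OF K] assms(1) l by metis
  then show "K #>\<^bsub>F\<^esub> (rep u \<otimes>\<^bsub>F\<^esub> [l]) = K #>\<^bsub>F\<^esub> rep (u \<otimes>\<^bsub>F\<^esub> [l])"
    using coset_rep[of "u \<otimes>\<^bsub>F\<^esub> [l]"] assms(1) l by (metis m_closed)
qed

lemma gens_in_K: "b \<in> gens \<Longrightarrow> b \<in> K"
  using step_in_K by (auto simp: gens_def gen_def)


text \<open>Crossing an edge backwards gives the inverse of the loop through the same edge crossed
  forwards, so positive letters suffice in \<open>gens\<close>.\<close>

lemma gens_inverse_letter:
  assumes u: "u \<in> carrier F" and x: "x \<in> X"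
  shows "rep u \<otimes>\<^bsub>F\<^esub> [(x, False)] \<otimes>\<^bsub>F\<^esub> inv\<^bsub>F\<^esub> rep (u \<otimes>\<^bsub>F\<^esub> [(x, False)]) =
    inv\<^bsub>F\<^esub> gen (u \<otimes>\<^bsub>F\<^esub> [(x, False)]) x"
proof -
  let ?p = "[(x, True)]" and ?n = "[(x, False)]"
  have l: "?p \<in> carrier F" "?n \<in> carrier F" using x by simp_all
  have np: "?n \<otimes>\<^bsub>F\<^esub> ?p = \<one>\<^bsub>F\<^esub>" by (simp add: flip_letter_def)
  then have inv: "inv\<^bsub>F\<^esub> ?p = ?n" using l by (metis inv_equality)
  have "u \<otimes>\<^bsub>F\<^esub> ?n \<otimes>\<^bsub>F\<^esub> ?p = u"
    using u l np by (simp only: m_assoc r_one)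
  then have "gen (u \<otimes>\<^bsub>F\<^esub> ?n) x = rep (u \<otimes>\<^bsub>F\<^esub> ?n) \<otimes>\<^bsub>F\<^esub> ?p \<otimes>\<^bsub>F\<^esub> inv\<^bsub>F\<^esub> rep u"
    by (simp only: gen_def)
  moreover have "rep (u \<otimes>\<^bsub>F\<^esub> ?n) \<in> carrier F" "rep u \<in> carrier F"
    using u l by (simp_all only: rep_closed m_closed)
  ultimately show ?thesis
    using l inv by (simp only: inv_mult_group m_closed inv_closed inv_inv m_assoc)
qed

section \<open>Rewriting in the Schreier generators\<close>

abbreviation B where "B \<equiv> free_group gens"

text \<open>\<open>gens\<close> excludes the identity, so an edge with trivial generator has no
  letter of its own and is read as the empty word.\<close>

definition edge :: "'x letter list \<Rightarrow> 'x \<Rightarrow> 'x letter list letter list"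
  where "edge u x = (if gen u x = [] then [] else [(gen u x, True)])"

text \<open>The edge crossed backwards by a negative letter \<open>l\<close> ends at
  \<open>u\<close> and starts at \<open>u\<close> times \<open>[l]\<close>; this explains the
  shifted base point as well as the inverse.\<close>

definition edge_letter :: "'x letter list \<Rightarrow> 'x letter \<Rightarrow> 'x letter list letter list"
  where "edge_letter u l =
    (if snd l then edge u (fst l) else inv\<^bsub>B\<^esub> edge (u \<otimes>\<^bsub>F\<^esub> [l]) (fst l))"

text \<open>Reidemeister-Schreier rewriting: follow \<open>w\<close> through the coset graph from
  the coset of \<open>u\<close> and record the edges crossed as an element of the abstract free
  group on \<open>gens\<close>. A group element \<open>u\<close> is carried instead of its coset;
  \<open>rewrite_translate\<close> shows that only the coset matters.\<close>

primrec rewrite :: "'x letter list \<Rightarrow> 'x letter list \<Rightarrow> 'x letter list letter list"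
  where
    "rewrite u [] = \<one>\<^bsub>B\<^esub>"
  | "rewrite u (l # w) = edge_letter u l \<otimes>\<^bsub>B\<^esub> rewrite (u \<otimes>\<^bsub>F\<^esub> [l]) w"

declare free_group_simps(2,3) [simp del]

interpretation B: group B by (rule group_free_group)

lemma edge_closed: "u \<in> carrier F \<Longrightarrow> x \<in> X \<Longrightarrow> edge u x \<in> carrier B"
  by (auto simp: edge_def gens_def)

lemma mult_letter_closed: "u \<in> carrier F \<Longrightarrow> fst l \<in> X \<Longrightarrow> u \<otimes>\<^bsub>F\<^esub> [l] \<in> carrier F"
  by (intro m_closed) simp_all

lemma edge_letter_closed: "u \<in> carrier F \<Longrightarrow> fst l \<in> X \<Longrightarrow> edge_letter u l \<in> carrier B"
  unfolding edge_letter_def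
  using edge_closed[of u "fst l"] edge_closed[OF mult_letter_closed[of u l], of "fst l"]
  by (simp del: free_group_simps)

lemma mult_flip:
  assumes "u \<in> carrier F" "fst l \<in> X"
  shows "u \<otimes>\<^bsub>F\<^esub> [l] \<otimes>\<^bsub>F\<^esub> [flip_letter l] = u"
proof -
  have "[l] \<in> carrier F" "[flip_letter l] \<in> carrier F" using assms(2) by simp_all
  moreover have "[l] \<otimes>\<^bsub>F\<^esub> [flip_letter l] = \<one>\<^bsub>F\<^esub>" by (simp add: free_group_simps)
  ultimately show ?thesis using assms(1) by (simp only: m_assoc r_one)
qed

lemma edge_letter_flip:
  assumes "u \<in> carrier F" "fst l \<in> X"
  shows "edge_letter u l \<otimes>\<^bsub>B\<^esub> edge_letter (u \<otimes>\<^bsub>F\<^esub> [l]) (flip_letter l) = \<one>\<^bsub>B\<^esub>"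
proof -
  obtain x s where l: "l = (x, s)" by fastforce
  show ?thesis
    using mult_flip[OF assms] edge_closed[OF assms]
      edge_closed[OF mult_letter_closed[OF assms] assms(2)]
    by (cases s) (simp_all add: l edge_letter_def flip_letter_def del: free_group_simps)
qed

lemma rewrite_closed:
  "u \<in> carrier F \<Longrightarrow> fst ` set w \<subseteq> X \<Longrightarrow> rewrite u w \<in> carrier B"
proof (induction w arbitrary: u)
  case (Cons l w)
  then show ?case
    using edge_letter_closed[of u l] mult_letter_closed[of u l]
    by (simp del: free_group_simps)
qed (simp del: free_group_simps)

text \<open>Cancelling a letter deletes an edge that is crossed and at once crossed back, and these
  two contributions are inverse to each other. So rewriting respects free reduction.\<close>

lemma rewrite_push:
  assumes "u \<in> carrier F" "fst l \<in> X" "fst ` set w \<subseteq> X"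
  shows "rewrite u (push_letter l w) = edge_letter u l \<otimes>\<^bsub>B\<^esub> rewrite (u \<otimes>\<^bsub>F\<^esub> [l]) w"
proof (cases "\<exists>v. w = flip_letter l # v")
  case True
  then obtain v where w: "w = flip_letter l # v" by blast
  have "rewrite u v = \<one>\<^bsub>B\<^esub> \<otimes>\<^bsub>B\<^esub> rewrite u v"
    using rewrite_closed[OF assms(1), of v] assms(3) w by (simp del: free_group_simps)
  also have "\<dots> = edge_letter u l \<otimes>\<^bsub>B\<^esub> edge_letter (u \<otimes>\<^bsub>F\<^esub> [l]) (flip_letter l) \<otimes>\<^bsub>B\<^esub> rewrite u v"
    by (simp only: edge_letter_flip[OF assms(1,2)])
  also have "\<dots> = edge_letter u l \<otimes>\<^bsub>B\<^esub> (edge_letter (u \<otimes>\<^bsub>F\<^esub> [l]) (flip_letter l) \<otimes>\<^bsub>B\<^esub> rewrite u v)"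
    using assms w edge_letter_closed mult_letter_closed rewrite_closed
    by (intro B.m_assoc) (simp_all del: free_group_simps)
  finally show ?thesis using w mult_flip[OF assms(1,2)] by simp
next
  case False
  then have "push_letter l w = l # w" by (cases w) auto
  then show ?thesis by simp
qed

lemma carrier_ConsD:
  "l # w \<in> carrier (free_group Y) \<Longrightarrow>
    fst l \<in> Y \<and> w \<in> carrier (free_group Y) \<and> l # w = [l] \<otimes>\<^bsub>free_group Y\<^esub> w"
  using foldr_push_reduced[of "[l]" w]
  by (auto simp: reduced_word_def successively_Cons free_group_simps)

text \<open>A cocycle rule: the path of a product is the path of \<open>v\<close> followed by the
  path of \<open>w\<close> from the point where the first one ends. Cancellation between the two is
  absorbed by \<open>rewrite_push\<close>.\<close>

lemma rewrite_mult:
  assumes "u \<in> carrier F" "v \<in> carrier F" "w \<in> carrier F"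
  shows "rewrite u (v \<otimes>\<^bsub>F\<^esub> w) = rewrite u v \<otimes>\<^bsub>B\<^esub> rewrite (u \<otimes>\<^bsub>F\<^esub> v) w"
  using assms
proof (induction v arbitrary: u)
  case Nil
  have "[] \<otimes>\<^bsub>F\<^esub> w = w" "u \<otimes>\<^bsub>F\<^esub> [] = u"
    using Nil.prems(1) r_one[of u] by (simp_all add: free_group_simps)
  moreover have "rewrite u w \<in> carrier B" using Nil.prems by (intro rewrite_closed) auto
  ultimately show ?case by (simp del: free_group_simps)
next
  case (Cons l v)
  have l: "fst l \<in> X" "v \<in> carrier F" "l # v = [l] \<otimes>\<^bsub>F\<^esub> v"
    using carrier_ConsD[OF Cons.prems(2)] by auto
  then have ll: "[l] \<in> carrier F" by simp
  have ul: "u \<otimes>\<^bsub>F\<^esub> [l] \<in> carrier F" by (rule m_closed[OF Cons.prems(1) ll])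
  have vw: "v \<otimes>\<^bsub>F\<^esub> w \<in> carrier F" by (rule m_closed[OF l(2) Cons.prems(3)])
  have c: "edge_letter u l \<in> carrier B" "rewrite (u \<otimes>\<^bsub>F\<^esub> [l]) v \<in> carrier B"
    "rewrite (u \<otimes>\<^bsub>F\<^esub> [l] \<otimes>\<^bsub>F\<^esub> v) w \<in> carrier B"
    using edge_letter_closed[OF Cons.prems(1) l(1)] rewrite_closed[OF ul, of v]
      rewrite_closed[OF m_closed[OF ul l(2)], of w] l(2) Cons.prems(3) by simp_all
  have ulv: "u \<otimes>\<^bsub>F\<^esub> [l] \<otimes>\<^bsub>F\<^esub> v = u \<otimes>\<^bsub>F\<^esub> (l # v)"
    unfolding l(3) by (rule m_assoc[OF Cons.prems(1) ll l(2)])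
  have "rewrite u ((l # v) \<otimes>\<^bsub>F\<^esub> w) = rewrite u (push_letter l (v \<otimes>\<^bsub>F\<^esub> w))"
    by (simp add: free_group_simps)
  also have "\<dots> = edge_letter u l \<otimes>\<^bsub>B\<^esub> rewrite (u \<otimes>\<^bsub>F\<^esub> [l]) (v \<otimes>\<^bsub>F\<^esub> w)"
    using rewrite_push[OF Cons.prems(1) l(1)] vw by simp
  also have "\<dots> = edge_letter u l \<otimes>\<^bsub>B\<^esub> (rewrite (u \<otimes>\<^bsub>F\<^esub> [l]) v \<otimes>\<^bsub>B\<^esub>
      rewrite (u \<otimes>\<^bsub>F\<^esub> [l] \<otimes>\<^bsub>F\<^esub> v) w)"
    by (simp only: Cons.IH[OF ul l(2) Cons.prems(3)])
  finally show ?case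
    using c by (simp add: B.m_assoc ulv del: free_group_simps)
qed

lemma gen_translate:
  assumes "k \<in> K" "u \<in> carrier F" "x \<in> X"
  shows "gen (k \<otimes>\<^bsub>F\<^esub> u) x = gen u x"
proof -
  have l: "[(x, True)] \<in> carrier F" using assms(3) by simp
  have "k \<otimes>\<^bsub>F\<^esub> u \<otimes>\<^bsub>F\<^esub> [(x, True)] = k \<otimes>\<^bsub>F\<^esub> (u \<otimes>\<^bsub>F\<^esub> [(x, True)])"
    by (rule m_assoc[OF K_sub[OF assms(1)] assms(2) l])
  then show ?thesis
    using rep_translate[OF assms(1,2)] rep_translate[OF assms(1) m_closed[OF assms(2) l]]
    by (simp add: gen_def del: free_group_simps)
qed

text \<open>Left multiplication by an element of \<open>K\<close> changes none of the cosets
  visited. For elements of \<open>K\<close> the shift of base point in \<open>rewrite_mult\<close>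
  therefore disappears, and \<open>rewrite []\<close> becomes a homomorphism on
  \<open>K\<close>.\<close>

lemma rewrite_translate:
  assumes "k \<in> K" "u \<in> carrier F" "fst ` set w \<subseteq> X"
  shows "rewrite (k \<otimes>\<^bsub>F\<^esub> u) w = rewrite u w"
  using assms(2,3)
proof (induction w arbitrary: u)
  case (Cons l w)
  then have l: "fst l \<in> X" and ll: "[l] \<in> carrier F" by simp_all
  have ul: "u \<otimes>\<^bsub>F\<^esub> [l] \<in> carrier F" by (rule m_closed[OF Cons.prems(1) ll])
  have kul: "k \<otimes>\<^bsub>F\<^esub> u \<otimes>\<^bsub>F\<^esub> [l] = k \<otimes>\<^bsub>F\<^esub> (u \<otimes>\<^bsub>F\<^esub> [l])"
    by (rule m_assoc[OF K_sub[OF assms(1)] Cons.prems(1) ll])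
  have "edge_letter (k \<otimes>\<^bsub>F\<^esub> u) l = edge_letter u l"
    by (simp add: edge_letter_def edge_def kul gen_translate[OF assms(1) ul l]
        gen_translate[OF assms(1) Cons.prems(1) l] del: free_group_simps)
  then show ?case
    using Cons.IH[OF ul] Cons.prems(2) by (simp add: kul del: free_group_simps)
qed simp

lemma Nil_closed: "[] \<in> carrier F"
  by simp

lemma Nil_mult: "u \<in> carrier F \<Longrightarrow> [] \<otimes>\<^bsub>F\<^esub> u = u"
  by (simp add: free_group_simps)

text \<open>The path of a representative runs inside the spanning tree, where all edges are trivial.\<close>

lemma rewrite_rep:
  assumes "t \<in> carrier F" "rep t = t"
  shows "rewrite [] t = \<one>\<^bsub>B\<^esub>"
  using assms
proof (induction t rule: rev_induct)
  case (snoc l p)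
  note p = rep_butlast[OF snoc.prems]
  obtain x s where xs: "l = (x, s)" by fastforce
  have x: "x \<in> X" using snoc.prems(1) xs by simp
  have ll: "[l] \<in> carrier F" using snoc.prems(1) by simp
  have pl: "p \<otimes>\<^bsub>F\<^esub> [l] = p @ [l]"
    using snoc.prems(1) foldr_push_reduced[of p "[l]"] by (simp add: free_group_simps)
  have lF: "p @ [l] \<in> carrier F" by (rule snoc.prems(1))
  have edge: "edge_letter p l = \<one>\<^bsub>B\<^esub>"
  proof (cases s)
    case True
    have "gen p x = []"
      using p snoc.prems pl r_inv[OF lF] unfolding gen_def
      by (simp add: xs True free_group_simps(3) del: free_group_simps(1))
    then show ?thesis by (simp add: edge_letter_def edge_def xs True free_group_simps(3))
  next
    case False
    \<comment> \<open>The last edge is read from its other end, leading from \<open>p @ [l]\<close>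
      back to \<open>p\<close>; both are their own representatives, so its generator is
      trivial.\<close>
    have "(p @ [l]) \<otimes>\<^bsub>F\<^esub> [(x, True)] = p"
      using mult_flip[of p l] p(1) x pl by (simp add: xs False flip_letter_def del: free_group_simps)
    then have "gen (p @ [l]) x = []"
      using p snoc.prems(2) r_inv[OF p(1)] unfolding gen_def
      by (simp add: free_group_simps(3) del: free_group_simps(1))
    then have "edge (p @ [l]) x = \<one>\<^bsub>B\<^esub>"
      by (simp add: edge_def xs False free_group_simps(3))
    then show ?thesis
      using pl by (simp add: edge_letter_def xs False del: free_group_simps)
  qed
  have "rewrite [] (p @ [l]) = rewrite [] p \<otimes>\<^bsub>B\<^esub> rewrite p [l]"
    using rewrite_mult[OF Nil_closed p(1) ll] pl Nil_mult[OF p(1)] by simp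
  then show ?case using snoc.IH[OF p] edge by (simp del: free_group_simps)
qed simp

lemma rewrite_hom: "rewrite [] \<in> hom (F\<lparr>carrier := K\<rparr>) B"
proof (rule homI)
  fix k k' assume k: "k \<in> carrier (F\<lparr>carrier := K\<rparr>)" "k' \<in> carrier (F\<lparr>carrier := K\<rparr>)"
  then have c: "k \<in> carrier F" "k' \<in> carrier F" by (auto dest: K_sub simp del: free_group_simps)
  show "rewrite [] k \<in> carrier B" using c(1) by (intro rewrite_closed) auto
  have "rewrite k k' = rewrite [] k'"
    using rewrite_translate[of k "[]" k'] k c r_one[OF c(1), unfolded free_group_simps(3)] by simp
  then show "rewrite [] (k \<otimes>\<^bsub>F\<lparr>carrier := K\<rparr>\<^esub> k') = rewrite [] k \<otimes>\<^bsub>B\<^esub> rewrite [] k'"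
    using rewrite_mult[OF Nil_closed c] Nil_mult[OF c(1)] by simp
qed

text \<open>Write \<open>b\<close> as \<open>t\<close> times \<open>x\<close> times the inverse of
  \<open>s\<close> with representatives \<open>t\<close> and \<open>s\<close>. Both outer pieces run
  inside the tree and rewrite to the identity, which leaves the letter of the middle edge.\<close>

lemma rewrite_gen:
  assumes "b \<in> gens"
  shows "rewrite [] b = [(b, True)]"
proof -
  obtain u x where u: "u \<in> carrier F" "x \<in> X" "b = gen u x" "b \<noteq> []"
    using assms by (auto simp: gens_def)
  let ?x = "[(x, True)]"
  define t where "t = rep u"
  define s where "s = rep (u \<otimes>\<^bsub>F\<^esub> ?x)"
  have x: "?x \<in> carrier F" using u(2) by simp
  have ux: "u \<otimes>\<^bsub>F\<^esub> ?x \<in> carrier F" by (rule m_closed[OF u(1) x])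
  have t: "t \<in> carrier F" and s: "s \<in> carrier F"
    unfolding s_def t_def by (rule rep_closed[OF u(1)], rule rep_closed[OF ux])
  have tx: "t \<otimes>\<^bsub>F\<^esub> ?x \<in> carrier F" and si: "inv\<^bsub>F\<^esub> s \<in> carrier F"
    using t s x by (simp_all only: m_closed inv_closed)
  have b: "b = t \<otimes>\<^bsub>F\<^esub> ?x \<otimes>\<^bsub>F\<^esub> inv\<^bsub>F\<^esub> s" by (simp only: u(3) gen_def t_def s_def)
  have bK: "b \<in> K" by (rule gens_in_K[OF assms])
  have bs: "b \<otimes>\<^bsub>F\<^esub> s = t \<otimes>\<^bsub>F\<^esub> ?x"
    unfolding b using tx s si by (simp only: m_assoc l_inv r_one)
  have rt: "rewrite [] t = \<one>\<^bsub>B\<^esub>" "rewrite [] s = \<one>\<^bsub>B\<^esub>"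
    unfolding t_def s_def by (intro rewrite_rep rep_closed rep_rep u(1) ux)+
  have cs: "rewrite s (inv\<^bsub>F\<^esub> s) \<in> carrier B" "rewrite t ?x \<in> carrier B"
    using rewrite_closed[OF s, of "inv\<^bsub>F\<^esub> s"] rewrite_closed[OF t, of ?x] si u(2)
    by (simp_all del: rewrite.simps)
  \<comment> \<open>Going out along \<open>s\<close> and back is trivial, and going out is already
    trivial, so the way back is trivial too.\<close>
  have "\<one>\<^bsub>B\<^esub> = rewrite [] (s \<otimes>\<^bsub>F\<^esub> inv\<^bsub>F\<^esub> s)"
    using s by (simp add: r_inv free_group_simps(3) del: free_group_simps(1))
  also have "\<dots> = rewrite s (inv\<^bsub>F\<^esub> s)"
    using rewrite_mult[OF Nil_closed s si] Nil_mult[OF s] rt cs by (simp del: free_group_simps)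
  finally have rs: "rewrite s (inv\<^bsub>F\<^esub> s) = \<one>\<^bsub>B\<^esub>" by simp
  have "gen t x = b"
    using rep_rep[OF u(1)] rep_mult_rep[OF u(1) x] by (simp only: t_def gen_def u(3))
  then have e: "rewrite t ?x = [(b, True)]"
    using u(4) assms by (simp add: edge_letter_def edge_def B.r_one)
  have "rewrite [] b = rewrite [] (t \<otimes>\<^bsub>F\<^esub> ?x) \<otimes>\<^bsub>B\<^esub> rewrite (t \<otimes>\<^bsub>F\<^esub> ?x) (inv\<^bsub>F\<^esub> s)"
    using rewrite_mult[OF Nil_closed tx si] Nil_mult[OF tx] by (simp only: b)
  \<comment> \<open>The return path starts at \<open>t\<close> times \<open>x\<close>, which equals
    \<open>b\<close> times \<open>s\<close> and so lies in the coset of \<open>s\<close>.\<close>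
  also have "rewrite (t \<otimes>\<^bsub>F\<^esub> ?x) (inv\<^bsub>F\<^esub> s) = \<one>\<^bsub>B\<^esub>"
    using rewrite_translate[OF bK s, of "inv\<^bsub>F\<^esub> s"] bs rs si by simp
  also have "rewrite [] (t \<otimes>\<^bsub>F\<^esub> ?x) = [(b, True)]"
    using rewrite_mult[OF Nil_closed t x] Nil_mult[OF t] rt(1) e cs(2)
    by (simp del: free_group_simps rewrite.simps)
  finally show ?thesis using e cs(2) by (simp del: free_group_simps rewrite.simps)
qed

text \<open>Rewriting is a left inverse of evaluation at \<open>gens\<close>: the composite is a
  homomorphism sending each generator to its own letter. This is the freeness half of the
  Nielsen-Schreier theorem.\<close>

lemma eval_gens_eq_Nil:
  assumes "w \<in> carrier B" "eval_word (F\<lparr>carrier := K\<rparr>) (\<lambda>b. b) w = \<one>\<^bsub>F\<^esub>"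
  shows "w = []"
proof -
  interpret h: group_hom "F\<lparr>carrier := K\<rparr>" B "rewrite []"
    using rewrite_hom subgroup_imp_group[OF K] B.is_group
    by (simp add: group_hom_def group_hom_axioms_def)
  have sub: "(\<lambda>b. b) ` fst ` set w \<subseteq> carrier (F\<lparr>carrier := K\<rparr>)"
    using assms(1) gens_in_K by auto
  have "w = eval_word B (\<lambda>b. [(b, True)]) w" by (rule eval_word_generators[OF assms(1), symmetric])
  also have "\<dots> = eval_word B (rewrite [] \<circ> (\<lambda>b. b)) w"
    using assms(1) by (intro eval_word_cong) (auto simp: rewrite_gen)
  also have "\<dots> = rewrite [] (\<one>\<^bsub>F\<^esub>)"
    using h.hom_eval_word[OF sub] assms(2) by simp
  finally show ?thesis by (simp add: free_group_simps(3))
qed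

section \<open>Generation by short Schreier generators\<close>

lemma length_mult_le: "length (u \<otimes>\<^bsub>F\<^esub> v) \<le> length u + length v"
  using foldr_push_append_or_less[of u v] by (auto simp: free_group_simps(2))

text \<open>Cut \<open>k\<close> at a letter into \<open>p\<close>, \<open>l\<close>,
  \<open>q\<close>. The representative of \<open>p\<close> is no longer than \<open>p\<close>; that
  of \<open>p @ [l]\<close> is no longer than \<open>q\<close>, because the inverse of
  \<open>q\<close> lies in the same coset. The generator at this letter thus has length at most that
  of \<open>p\<close>, plus one, plus that of \<open>q\<close>, which is the length of
  \<open>k\<close>.\<close>

lemma short_generators:
  assumes k: "k \<in> K"
  shows "\<exists>w \<in> carrier (free_group {b \<in> gens. length b \<le> length k}).
    eval_word (F\<lparr>carrier := K\<rparr>) (\<lambda>b. b) w = k"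
proof -
  let ?C = "{b \<in> gens. length b \<le> length k}"
  define S where "S = eval_word F (\<lambda>b. b) ` carrier (free_group ?C)"
  have CF: "(\<lambda>b. b) \<in> ?C \<rightarrow> carrier F" using gens_in_K K_sub by blast
  interpret e: group_hom "free_group ?C" F "eval_word F (\<lambda>b. b)"
    using eval_word_hom[OF CF] group_free_group is_group
    by (simp add: group_hom_def group_hom_axioms_def)
  have S: "subgroup S F" unfolding S_def by (rule e.img_is_subgroup)
  have C_S: "b \<in> S" if "b \<in> ?C" for b
  proof -
    have "b \<in> carrier F" using that by (intro K_sub gens_in_K) simp
    then have "eval_word F (\<lambda>b. b) [(b, True)] = b"
      by (simp add: eval_letter_def del: free_group_simps)
    moreover have "[(b, True)] \<in> carrier (free_group ?C)" using that by simp
    ultimately show ?thesis unfolding S_def by (intro image_eqI[of _ _ "[(b, True)]"]) simp_all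
  qed
  have kF: "k \<in> carrier F" by (rule K_sub[OF k])
  \<comment> \<open>Telescoping over prefixes: each further letter multiplies this element by one
    short generator or its inverse. At the full word the representative is \<open>[]\<close>, so the
    element is \<open>k\<close> itself.\<close>
  have "take i k \<otimes>\<^bsub>F\<^esub> inv\<^bsub>F\<^esub> rep (take i k) \<in> S" if "i \<le> length k" for i
    using that
  proof (induction i)
    case 0
    have "rep [] = []" using rep_in_K[OF subgroup.one_closed[OF K]] by (simp add: free_group_simps(3))
    then show ?case using subgroup.one_closed[OF S] r_inv[OF Nil_closed] by simp
  next
    case (Suc i)
    define p where "p = take i k"
    define q where "q = drop (Suc i) k"
    define l where "l = k ! i"
    have kpq: "k = p @ [l] @ q"
      unfolding p_def q_def l_def using Suc.prems by (simp add: id_take_nth_drop)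
    have len: "length k = Suc (length p + length q)" by (simp add: kpq)
    have red: "reduced_word (p @ [l])" "reduced_word q" "reduced_word p"
      using kF unfolding kpq by (auto simp: reduced_word_def successively_append_iff successively_Cons)
    have F: "p \<in> carrier F" "q \<in> carrier F" "p @ [l] \<in> carrier F" "[l] \<in> carrier F"
      using kF red by (auto simp: kpq)
    have pl: "p @ [l] = p \<otimes>\<^bsub>F\<^esub> [l]" using foldr_push_reduced[OF red(1)] by (simp add: free_group_simps(2))
    have k_eq: "k = (p @ [l]) \<otimes>\<^bsub>F\<^esub> q"
      using foldr_push_reduced[of "p @ [l]" q] kF unfolding kpq free_group_simps(2)
      by (simp only: append_assoc free_group_simps(1))
    obtain x s where xs: "l = (x, s)" by fastforce
    have x: "x \<in> X" using F(4) xs by simp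
    have repF: "rep p \<in> carrier F" "rep (p @ [l]) \<in> carrier F" by (simp_all only: rep_closed F)
    \<comment> \<open>This is where membership of the whole word \<open>k\<close> in
      \<open>K\<close> enters: it places the inverse of the suffix in the coset of the
      prefix.\<close>
    have "inv\<^bsub>F\<^esub> q = inv\<^bsub>F\<^esub> k \<otimes>\<^bsub>F\<^esub> (p @ [l])"
      unfolding k_eq using F(2,3)
      by (simp only: inv_mult_group m_assoc inv_closed l_inv r_one)
    then have "inv\<^bsub>F\<^esub> q \<in> K #>\<^bsub>F\<^esub> (p @ [l])"
      using subgroup.m_inv_closed[OF K k] by (auto simp: r_coset_def)
    then have "length (rep (p @ [l])) \<le> length q"
      using length_rep_le[OF F(3)] by (fastforce simp: inv_free_group[OF F(2)])
    moreover have "length (rep p) \<le> length p"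
      by (rule length_rep_le[OF F(1) rcos_self[OF F(1) K]])
    moreover define y where "y = rep p \<otimes>\<^bsub>F\<^esub> [l] \<otimes>\<^bsub>F\<^esub> inv\<^bsub>F\<^esub> rep (p @ [l])"
    have "length y \<le> length (rep p) + 1 + length (rep (p @ [l]))"
      using length_mult_le[of "rep p \<otimes>\<^bsub>F\<^esub> [l]" "inv\<^bsub>F\<^esub> rep (p @ [l])"]
        length_mult_le[of "rep p" "[l]"]
      by (simp add: y_def inv_free_group[OF repF(2)])
    ultimately have y_len: "length y \<le> length k" using len by linarith
    have gF: "gen (p @ [l]) x \<in> K" "gen p x \<in> K"
      using step_in_K[OF F(3), of "(x, True)"] step_in_K[OF F(1), of "(x, True)"] x
      by (simp_all only: gen_def fst_conv)
    have "y \<in> S"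
    proof (cases s)
      case True
      have y: "y = gen p x" using pl by (simp only: y_def gen_def xs True)
      show ?thesis
      proof (cases "y = []")
        case True
        then show ?thesis using subgroup.one_closed[OF S] by (simp add: free_group_simps(3))
      next
        case False
        then have "y \<in> ?C" using F(1) x y y_len by (auto simp: gens_def simp del: free_group_simps)
        then show ?thesis by (rule C_S)
      qed
    next
      case False
      have y: "y = inv\<^bsub>F\<^esub> gen (p @ [l]) x"
        using gens_inverse_letter[OF F(1) x] pl by (simp only: y_def xs False)
      have "gen (p @ [l]) x \<in> S"
      proof (cases "gen (p @ [l]) x = []")
        case True
        then show ?thesis using subgroup.one_closed[OF S] by (simp add: free_group_simps(3))
      next
        case False
        have "length (gen (p @ [l]) x) = length y"
          using inv_free_group[OF K_sub[OF gF(1)]] y by simp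
        then have "gen (p @ [l]) x \<in> ?C"
          using F(3) x False y_len by (auto simp: gens_def simp del: free_group_simps)
        then show ?thesis by (rule C_S)
      qed
      then show ?thesis unfolding y by (rule subgroup.m_inv_closed[OF S])
    qed
    then have "p \<otimes>\<^bsub>F\<^esub> inv\<^bsub>F\<^esub> rep p \<otimes>\<^bsub>F\<^esub> y \<in> S"
      using Suc.IH Suc.prems by (intro subgroup.m_closed[OF S _ \<open>y \<in> S\<close>]) (simp add: p_def)
    moreover have "p \<otimes>\<^bsub>F\<^esub> inv\<^bsub>F\<^esub> rep p \<otimes>\<^bsub>F\<^esub> y = (p @ [l]) \<otimes>\<^bsub>F\<^esub> inv\<^bsub>F\<^esub> rep (p @ [l])"
    proof -
      have "inv\<^bsub>F\<^esub> rep p \<otimes>\<^bsub>F\<^esub> y = [l] \<otimes>\<^bsub>F\<^esub> inv\<^bsub>F\<^esub> rep (p @ [l])"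
        unfolding y_def using repF F(4)
        by (simp only: m_assoc[symmetric] inv_closed m_closed l_inv l_one)
      then have "p \<otimes>\<^bsub>F\<^esub> inv\<^bsub>F\<^esub> rep p \<otimes>\<^bsub>F\<^esub> y = p \<otimes>\<^bsub>F\<^esub> ([l] \<otimes>\<^bsub>F\<^esub> inv\<^bsub>F\<^esub> rep (p @ [l]))"
        using F(1,4) repF
        by (simp only: y_def m_assoc inv_closed m_closed)
      also have "\<dots> = p \<otimes>\<^bsub>F\<^esub> [l] \<otimes>\<^bsub>F\<^esub> inv\<^bsub>F\<^esub> rep (p @ [l])"
        using F(1,4) repF by (simp only: m_assoc inv_closed)
      finally show ?thesis by (simp only: pl)
    qed
    moreover have "take (Suc i) k = p @ [l]"
      unfolding p_def l_def using Suc.prems by (simp add: take_Suc_conv_app_nth)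
    ultimately show ?case by simp
  qed
  from this[of "length k"] have "k \<otimes>\<^bsub>F\<^esub> inv\<^bsub>F\<^esub> \<one>\<^bsub>F\<^esub> \<in> S"
    using rep_in_K[OF k] by (simp add: free_group_simps(3))
  then have "k \<in> S" using kF by (simp only: inv_one r_one)
  then obtain w where w: "w \<in> carrier (free_group ?C)" "k = eval_word F (\<lambda>b. b) w"
    unfolding S_def by blast
  have "(\<lambda>b. b) ` fst ` set w \<subseteq> K" using w(1) gens_in_K by auto
  then show ?thesis using w eval_word_subgroup[OF K, of "\<lambda>b. b" w] by force
qed

lemma free_family_gens: "free_family (F\<lparr>carrier := K\<rparr>) gens (\<lambda>b. b)"
proof -
  interpret K: group "F\<lparr>carrier := K\<rparr>" by (rule subgroup_imp_group[OF K])
  show ?thesis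
  proof (rule K.free_familyI)
    show "(\<lambda>b. b) \<in> gens \<rightarrow> carrier (F\<lparr>carrier := K\<rparr>)" using gens_in_K by simp
  next
    fix k assume "k \<in> carrier (F\<lparr>carrier := K\<rparr>)"
    then have "k \<in> K" by simp
    from short_generators[OF this] obtain w
      where w: "w \<in> carrier (free_group {b \<in> gens. length b \<le> length k})"
        "eval_word (F\<lparr>carrier := K\<rparr>) (\<lambda>b. b) w = k" by blast
    have "w \<in> carrier B" using w(1) by auto
    then show "\<exists>w \<in> carrier B. eval_word (F\<lparr>carrier := K\<rparr>) (\<lambda>b. b) w = k"
      using w(2) by blast
  next
    fix w assume "w \<in> carrier B" "eval_word (F\<lparr>carrier := K\<rparr>) (\<lambda>b. b) w = \<one>\<^bsub>F\<lparr>carrier := K\<rparr>\<^esub>"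
    then show "w = []" by (intro eval_gens_eq_Nil) simp_all
  qed
qed

end

text \<open>Nielsen-Schreier with a length bound: an element is expressible by basis elements no
  longer than itself. The bound later confines a whole basis to a finite ball.\<close>

lemma subgroup_free_group_basis:
  assumes "subgroup K (free_group X)"
  shows "\<exists>C. free_family (free_group X\<lparr>carrier := K\<rparr>) C (\<lambda>b. b) \<and>
    (\<forall>k \<in> K. \<exists>w \<in> carrier (free_group {b \<in> C. length b \<le> length k}).
      eval_word (free_group X\<lparr>carrier := K\<rparr>) (\<lambda>b. b) w = k)"
proof -
  obtain r :: "'a letter rel" where wo: "well_order_on UNIV r" using well_order_on by blast
  interpret schreier X K r by (rule schreier.intro[OF assms wo])
  show ?thesis by (intro exI[of _ gens] conjI ballI free_family_gens short_generators)
qed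

section \<open>Residual finiteness and the Hopf property\<close>

text \<open>In a finite set the complements of domain and range have equal size, so any bijection
  between them completes the partial map.\<close>

lemma partial_injection_extends:
  assumes "finite S" "inj_on f A" "A \<subseteq> S" "f ` A \<subseteq> S"
  shows "\<exists>h \<in> Bij S. \<forall>a \<in> A. h a = f a"
proof -
  have "card (f ` A) = card A" by (rule card_image[OF assms(2)])
  moreover have "finite A" using assms(1,3) finite_subset by blast
  ultimately have "card (S - A) = card (S - f ` A)"
    using assms(3,4) by (simp add: card_Diff_subset)
  then obtain k where k: "bij_betw k (S - A) (S - f ` A)"
    using finite_same_card_bij[of "S - A" "S - f ` A"] assms(1) by blast
  let ?h = "\<lambda>x. if x \<in> A then f x else k x"
  have "bij_betw ?h (A \<union> (S - A)) (f ` A \<union> (S - f ` A))"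
  proof (rule bij_betw_combine)
    show "bij_betw ?h A (f ` A)"
      using assms(2) by (simp add: bij_betw_def inj_on_def)
    show "bij_betw ?h (S - A) (S - f ` A)"
      using k by (subst bij_betw_cong[of _ _ k]) auto
  qed auto
  then have "bij_betw ?h S S" using assms(3,4) by (simp add: Un_absorb1)
  then have "restrict ?h S \<in> Bij S" by (simp add: Bij_def)
  moreover have "\<forall>a \<in> A. restrict ?h S a = f a" using assms(3) by auto
  ultimately show ?thesis by blast
qed

text \<open>
  The permutations send position \<open>Suc i\<close> of the word to position \<open>i\<close> along the \<open>i\<close>-th letter,
  so the value of the word moves its last position to its first.
\<close>

lemma free_group_residually_finite:
  assumes w: "w \<in> carrier (free_group X)" "w \<noteq> []"
  obtains N :: nat and g where "g \<in> X \<rightarrow> carrier (BijGroup {..N})"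
    "eval_word (BijGroup {..N}) g w \<noteq> \<one>\<^bsub>BijGroup {..N}\<^esub>"
proof -
  define N where "N = length w"
  let ?Q = "BijGroup {..N}"
  interpret Q: group ?Q by (rule group_BijGroup)
  have red: "w ! Suc i \<noteq> flip_letter (w ! i)" if "Suc i < N" for i
    using w(1) that by (simp add: reduced_word_def successively_conv_nth N_def)
  have "\<exists>h \<in> Bij {..N}. \<forall>i<N. (w ! i = (x, True) \<longrightarrow> h (Suc i) = i)
      \<and> (w ! i = (x, False) \<longrightarrow> h i = Suc i)" for x
  proof -
    \<comment> \<open>The points at which the permutation for \<open>x\<close> is prescribed:
      \<open>D1\<close> by positive occurrences of \<open>x\<close>, \<open>D2\<close> by negative
      ones. A clash of sources or of values would need adjacent mutually inverse letters, which
      reducedness excludes.\<close>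
    define D1 where "D1 = {Suc i | i. i < N \<and> w ! i = (x, True)}"
    define D2 where "D2 = {i. i < N \<and> w ! i = (x, False)}"
    define f where "f = (\<lambda>j. if j \<in> D1 then j - 1 else Suc j)"
    have disj: "Suc i \<notin> D2" if "i < N" "w ! i = (x, True)" for i
      using red[of i] that by (auto simp: D2_def flip_letter_def)
    have disj': "Suc i \<notin> D1" if "i < N" "w ! i = (x, False)" for i
      using that by (auto simp: D1_def)
    have cross: False if "i < N" "w ! i = (x, True)" "j < N" "w ! j = (x, False)" "i = Suc j" for i j
      using red[of j] that by (auto simp: flip_letter_def)
    have f1: "f (Suc i) = i" if "i < N" "w ! i = (x, True)" for i
      using that by (auto simp: f_def D1_def)
    have f2: "f i = Suc i" if "i < N" "w ! i = (x, False)" for i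
    proof -
      have "i \<notin> D1" using that disj by (auto simp: D1_def D2_def)
      then show ?thesis by (simp add: f_def)
    qed
    have "inj_on f (D1 \<union> D2)"
    proof (rule inj_onI)
      fix a b assume ab: "a \<in> D1 \<union> D2" "b \<in> D1 \<union> D2" "f a = f b"
      then show "a = b"
        using f1 f2 cross unfolding D1_def D2_def by auto metis+
    qed
    moreover have "f ` (D1 \<union> D2) \<subseteq> {..N}" "D1 \<union> D2 \<subseteq> {..N}"
      using f1 f2 by (auto simp: D1_def D2_def)
    ultimately obtain h where "h \<in> Bij {..N}" "\<forall>a \<in> D1 \<union> D2. h a = f a"
      using partial_injection_extends[of "{..N}" f "D1 \<union> D2"] by auto
    then show ?thesis
      using f1 f2 by (intro bexI[of _ h]) (auto simp: D1_def D2_def)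
  qed
  then obtain g where g: "\<And>x. g x \<in> Bij {..N}"
    "\<And>x i. i < N \<Longrightarrow> w ! i = (x, True) \<Longrightarrow> g x (Suc i) = i"
    "\<And>x i. i < N \<Longrightarrow> w ! i = (x, False) \<Longrightarrow> g x i = Suc i"
    by metis
  have gQ: "g x \<in> carrier ?Q" for x using g(1) by (simp add: BijGroup_def)
  have "eval_word ?Q g (drop i w) N = i" if "i \<le> N" for i
    using that
  proof (induction rule: inc_induct)
    case base
    then show ?case by (simp add: N_def BijGroup_def)
  next
    case (step i)
    obtain x s where l: "w ! i = (x, s)" by fastforce
    have E: "eval_word ?Q g (drop (Suc i) w) \<in> carrier ?Q"
      using gQ by (intro Q.eval_word_closed) auto
    have L: "eval_letter ?Q g (w ! i) \<in> carrier ?Q"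
      using gQ by (intro Q.eval_letter_closed)
    have "eval_letter ?Q g (w ! i) (Suc i) = i"
    proof (cases s)
      case True
      then show ?thesis using g(2)[OF step(2)] l by (simp add: eval_letter_def)
    next
      case False
      have "g x i = Suc i" using g(3)[OF step(2)] l False by simp
      moreover have "inj_on (g x) {..N}" using g(1)[of x] by (simp add: Bij_def bij_betw_def)
      ultimately have "inv_into {..N} (g x) (Suc i) = i"
        using step(2) inv_into_f_f[of "g x" "{..N}" i] by simp
      then show ?thesis
        using step(2) l False by (simp add: eval_letter_def inv_BijGroup[OF g(1)])
    qed
    moreover have "a \<otimes>\<^bsub>?Q\<^esub> b = compose {..N} a b" if "a \<in> carrier ?Q" "b \<in> carrier ?Q" for a b
      using that by (simp add: BijGroup_def)
    from this[OF L E]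
    have "eval_word ?Q g (w ! i # drop (Suc i) w) N
        = eval_letter ?Q g (w ! i) (eval_word ?Q g (drop (Suc i) w) N)"
      by (simp add: compose_def)
    moreover have "w ! i # drop (Suc i) w = drop i w"
      using step(2) Cons_nth_drop_Suc[of i w] by (simp add: N_def)
    ultimately show ?case using step.IH by simp
  qed
  from this[of 0] have "eval_word ?Q g w N = 0" by simp
  moreover have "\<one>\<^bsub>?Q\<^esub> N = N" by (simp add: BijGroup_def)
  ultimately have "eval_word ?Q g w \<noteq> \<one>\<^bsub>?Q\<^esub>" using w(2) by (auto simp: N_def)
  then show thesis using gQ by (intro that[of g N]) auto
qed

text \<open>
  Precomposition with a surjective endomorphism permutes the finitely many homomorphisms to a given
  finite group, so its kernel is contained in all their kernels.
\<close>

lemma free_family_hopfian: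
  assumes L: "group L" and fam: "free_family L I g" and "finite I"
    and \<theta>: "\<theta> \<in> hom L L" "\<theta> ` carrier L = carrier L"
  shows "inj_on \<theta> (carrier L)"
proof -
  interpret L: group L by (rule L)
  interpret \<theta>: group_hom L L \<theta>
    using \<theta>(1) L by (simp add: group_hom_def group_hom_axioms_def)
  have "x = \<one>\<^bsub>L\<^esub>" if x: "x \<in> carrier L" "\<theta> x = \<one>\<^bsub>L\<^esub>" for x
  proof (rule ccontr)
    assume "x \<noteq> \<one>\<^bsub>L\<^esub>"
    obtain w where w: "reduced_word w" "fst ` set w \<subseteq> I" "x = eval_word L g w"
      using free_familyE[OF fam x(1)] .
    have "w \<in> carrier (free_group I)" "w \<noteq> []"
      using w \<open>x \<noteq> \<one>\<^bsub>L\<^esub>\<close> by auto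
    then obtain N q where q: "q \<in> I \<rightarrow> carrier (BijGroup {..N::nat})"
      "eval_word (BijGroup {..N}) q w \<noteq> \<one>\<^bsub>BijGroup {..N}\<^esub>"
      by (rule free_group_residually_finite)
    let ?Q = "BijGroup {..N}"
    have Q: "group ?Q" by (rule group_BijGroup)
    have "carrier ?Q \<subseteq> {..N} \<rightarrow>\<^sub>E {..N}"
      by (auto simp: BijGroup_def Bij_def PiE_def bij_betw_def)
    then have "finite (carrier ?Q)"
      using finite_PiE[of "{..N}" "\<lambda>_. {..N}"] finite_subset by blast
    \<comment> \<open>Homomorphisms to \<open>?Q\<close> are encoded by their values on the basis;
      \<open>T\<close> below is precomposition with \<open>\<theta>\<close> on these codes.\<close>
    define A where "A = I \<rightarrow>\<^sub>E carrier ?Q"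
    have "finite A" unfolding A_def using \<open>finite I\<close> \<open>finite (carrier ?Q)\<close> by (simp add: finite_PiE)
    have "\<exists>h \<in> hom L ?Q. \<forall>i \<in> I. h (g i) = a i" if "a \<in> A" for a
      using that by (intro L.free_family_extend[OF fam Q]) (auto simp: A_def)
    then obtain h where h: "\<And>a. a \<in> A \<Longrightarrow> h a \<in> hom L ?Q"
      "\<And>a i. a \<in> A \<Longrightarrow> i \<in> I \<Longrightarrow> h a (g i) = a i" by metis
    define T where "T a = restrict (\<lambda>i. h a (\<theta> (g i))) I" for a
    have "h a (\<theta> (g i)) \<in> carrier ?Q" if "a \<in> A" "i \<in> I" for a i
      using hom_in_carrier[OF h(1)[OF that(1)] \<theta>.hom_closed[OF free_family_mem[OF fam that(2)]]] .
    then have "T ` A \<subseteq> A" by (auto simp: T_def A_def)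
    have "inj_on T A"
    proof (rule inj_onI)
      fix a b assume ab: "a \<in> A" "b \<in> A" "T a = T b"
      have "(h a \<circ> \<theta>) y = (h b \<circ> \<theta>) y" if "y \<in> carrier L" for y
      proof (rule free_family_hom_eq[OF fam L Q _ _ _ that])
        show "h a \<circ> \<theta> \<in> hom L ?Q" "h b \<circ> \<theta> \<in> hom L ?Q"
          using h(1) ab \<theta>(1) Group.hom_compose by blast+
        show "(h a \<circ> \<theta>) (g i) = (h b \<circ> \<theta>) (g i)" if "i \<in> I" for i
          using fun_cong[OF ab(3), of i] that by (simp add: T_def)
      qed
      then have eq: "h a z = h b z" if "z \<in> carrier L" for z
        using that \<theta>(2) by (metis comp_apply imageE)
      show "a = b"
      proof (rule PiE_ext)
        show "a \<in> I \<rightarrow>\<^sub>E carrier ?Q" "b \<in> I \<rightarrow>\<^sub>E carrier ?Q" using ab by (simp_all add: A_def)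
        show "a i = b i" if "i \<in> I" for i
          using h(2)[OF ab(1) that] h(2)[OF ab(2) that] eq[OF free_family_mem[OF fam that]] by simp
      qed
    qed
    then have "T ` A = A" using endo_inj_surj \<open>finite A\<close> \<open>T ` A \<subseteq> A\<close> by blast
    moreover have "restrict q I \<in> A" using q(1) by (auto simp: A_def)
    \<comment> \<open>The homomorphism that detects \<open>x\<close> is itself a precomposition with
      \<open>\<theta>\<close>, so it must kill \<open>x\<close>.\<close>
    ultimately obtain a where a: "a \<in> A" "T a = restrict q I" by (metis imageE)
    interpret ha: group_hom L ?Q "h a \<circ> \<theta>"
      using Group.hom_compose[OF \<theta>(1) h(1)[OF a(1)]] L Q
      by (simp add: group_hom_def group_hom_axioms_def)
    interpret h: group_hom L ?Q "h a"
      using h(1)[OF a(1)] L Q by (simp add: group_hom_def group_hom_axioms_def)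
    have "eval_word ?Q q w = eval_word ?Q ((h a \<circ> \<theta>) \<circ> g) w"
    proof (rule eval_word_cong)
      fix i assume "i \<in> fst ` set w"
      then have "i \<in> I" using w(2) by blast
      then show "q i = ((h a \<circ> \<theta>) \<circ> g) i"
        using fun_cong[OF a(2), of i] by (simp add: T_def)
    qed
    also have "\<dots> = (h a \<circ> \<theta>) x"
    proof -
      have "g ` fst ` set w \<subseteq> carrier L" using w(2) free_family_mem[OF fam] by blast
      from ha.hom_eval_word[OF this] show ?thesis using w(3) by simp
    qed
    also have "\<dots> = \<one>\<^bsub>?Q\<^esub>" using x(2) by simp
    finally show False using q(2) by simp
  qed
  then show ?thesis by (simp add: \<theta>.inj_on_one_iff)
qed

section \<open>Products of squares\<close>

definition xor_group :: "bool monoid"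
  where "xor_group = \<lparr>carrier = UNIV, monoid.mult = (\<noteq>), one = False\<rparr>"

text \<open>Upper unitriangular \<open>3 \<times> 3\<close> matrices over the field with two elements.\<close>

definition heisenberg_group :: "(bool \<times> bool \<times> bool) monoid"
  where "heisenberg_group = \<lparr>carrier = UNIV,
    monoid.mult = (\<lambda>(a, b, c) (a', b', c'). (a \<noteq> a', b \<noteq> b', (c \<noteq> c') \<noteq> (a \<and> b'))),
    one = (False, False, False)\<rparr>"

lemma group_xor_group: "group xor_group"
  by (rule groupI) (auto simp: xor_group_def)

lemma group_heisenberg_group: "group heisenberg_group"
proof (rule groupI)
  fix x assume "x \<in> carrier heisenberg_group"
  obtain a b c where "x = (a, b, c)" by (metis prod_cases3)
  then show "\<exists>y \<in> carrier heisenberg_group.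
      y \<otimes>\<^bsub>heisenberg_group\<^esub> x = \<one>\<^bsub>heisenberg_group\<^esub>"
    by (intro bexI[of _ "(a, b, c \<noteq> (a \<and> b))"]) (auto simp: heisenberg_group_def)
qed (auto simp: heisenberg_group_def)

section \<open>Parity form and its invariance\<close>

definition square_word :: "'i list \<Rightarrow> 'i letter list"
  where "square_word js = concat (map (\<lambda>j. [(j, True), (j, True)]) js)"

lemma letters_square_word [simp]: "fst ` set (square_word js) = set js"
  by (force simp: square_word_def)

text \<open>The standard dot product over the field with two elements, with inequality of booleans
  as addition.\<close>

definition parity_form :: "'i list \<Rightarrow> ('i \<Rightarrow> bool) \<Rightarrow> ('i \<Rightarrow> bool) \<Rightarrow> bool"
  where "parity_form js a b = foldr (\<lambda>j p. (a j \<and> b j) \<noteq> p) js False"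

text \<open>The square of \<open>(a, b, c)\<close> is the central element
  \<open>(False, False, a \<and> b)\<close>, so in a product of squares the corner entries simply
  add up.\<close>

lemma eval_square_word:
  "eval_word heisenberg_group f (square_word js) =
    (False, False, parity_form js (fst \<circ> f) (fst \<circ> snd \<circ> f))"
proof (induction js)
  case (Cons j js)
  obtain a b c where "f j = (a, b, c)" by (metis prod_cases3)
  then show ?case
    using Cons by (auto simp: square_word_def parity_form_def eval_letter_def heisenberg_group_def)
qed (simp add: square_word_def parity_form_def heisenberg_group_def)

text \<open>Nondegeneracy: pairing with an indicator reads off a coordinate. A repeated index would
  cancel against itself modulo two, hence \<open>distinct\<close>.\<close>

lemma parity_form_dual:
  "distinct js \<Longrightarrow> parity_form js a (\<lambda>i. i = j) \<longleftrightarrow> j \<in> set js \<and> a j"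
  by (induction js) (auto simp: parity_form_def)

lemma parity_form_cong:
  "(\<And>j. j \<in> set js \<Longrightarrow> a j = a' j) \<Longrightarrow> (\<And>j. j \<in> set js \<Longrightarrow> b j = b' j) \<Longrightarrow>
    parity_form js a b = parity_form js a' b'"
  by (induction js) (auto simp: parity_form_def)

text \<open>
  Both sides are corner entries of the value of the same element under the homomorphism to the
  Heisenberg group with off-diagonal entries \<open>\<chi>\<close> and \<open>\<beta>\<close>.
\<close>

lemma parity_form_invariant:
  assumes L: "group L" and fam: "free_family L I g" and js: "set js \<subseteq> I"
    and \<phi>: "\<phi> \<in> hom L L" "\<phi> (eval_word L g (square_word js)) = eval_word L g (square_word js)"
    and \<chi>: "\<chi> \<in> hom L xor_group" and \<beta>: "\<beta> \<in> hom L xor_group"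
  shows "parity_form js (\<chi> \<circ> g) (\<beta> \<circ> g) = parity_form js (\<chi> \<circ> \<phi> \<circ> g) (\<beta> \<circ> \<phi> \<circ> g)"
proof -
  interpret L: group L by (rule L)
  let ?D = heisenberg_group
  obtain \<Theta> where \<Theta>: "\<Theta> \<in> hom L ?D" "\<And>i. i \<in> I \<Longrightarrow> \<Theta> (g i) = (\<chi> (g i), \<beta> (g i), False)"
    using L.free_family_extend[OF fam group_heisenberg_group, of "\<lambda>i. (\<chi> (g i), \<beta> (g i), False)"]
    by (auto simp: heisenberg_group_def)
  have pr: "fst \<in> hom ?D xor_group" "fst \<circ> snd \<in> hom ?D xor_group"
    by (auto simp: hom_def heisenberg_group_def xor_group_def)
  have 1: "(fst \<circ> \<Theta>) x = \<chi> x" if "x \<in> carrier L" for x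
    by (rule free_family_hom_eq[OF fam L group_xor_group Group.hom_compose[OF \<Theta>(1) pr(1)] \<chi> _ that])
      (simp add: \<Theta>(2))
  have 2: "((fst \<circ> snd) \<circ> \<Theta>) x = \<beta> x" if "x \<in> carrier L" for x
    by (rule free_family_hom_eq[OF fam L group_xor_group Group.hom_compose[OF \<Theta>(1) pr(2)] \<beta> _ that])
      (simp add: \<Theta>(2))
  interpret \<Theta>: group_hom L ?D \<Theta>
    using L group_heisenberg_group \<Theta>(1) by (simp add: group_hom_def group_hom_axioms_def)
  interpret \<phi>: group_hom L L \<phi>
    using L \<phi>(1) by (simp add: group_hom_def group_hom_axioms_def)
  have g: "g ` fst ` set (square_word js) \<subseteq> carrier L"
    "(\<phi> \<circ> g) ` fst ` set (square_word js) \<subseteq> carrier L"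
    using js free_family_mem[OF fam] \<phi>.hom_closed by auto
  have "eval_word ?D (\<Theta> \<circ> g) (square_word js) = eval_word ?D (\<Theta> \<circ> (\<phi> \<circ> g)) (square_word js)"
    using \<Theta>.hom_eval_word[OF g(1)] \<Theta>.hom_eval_word[OF g(2)] \<phi>.hom_eval_word[OF g(1)] \<phi>(2)
    by argo
  then have "parity_form js (fst \<circ> (\<Theta> \<circ> g)) (fst \<circ> snd \<circ> (\<Theta> \<circ> g)) =
      parity_form js (fst \<circ> (\<Theta> \<circ> (\<phi> \<circ> g))) (fst \<circ> snd \<circ> (\<Theta> \<circ> (\<phi> \<circ> g)))"
    unfolding eval_square_word by simp
  \<comment> \<open>Stated for general \<open>f\<close> in order to serve both \<open>g\<close> and
    \<open>\<phi> \<circ> g\<close>.\<close>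
  moreover have "parity_form js (fst \<circ> (\<Theta> \<circ> f)) (fst \<circ> snd \<circ> (\<Theta> \<circ> f)) =
      parity_form js (\<chi> \<circ> f) (\<beta> \<circ> f)" if "f ` set js \<subseteq> carrier L" for f
  proof (rule parity_form_cong)
    fix j assume "j \<in> set js"
    then have "f j \<in> carrier L" using that by blast
    from 1[OF this] 2[OF this]
    show "(fst \<circ> (\<Theta> \<circ> f)) j = (\<chi> \<circ> f) j" "(fst \<circ> snd \<circ> (\<Theta> \<circ> f)) j = (\<beta> \<circ> f) j" by simp_all
  qed
  ultimately show ?thesis
    using g by (simp add: comp_assoc)
qed

text \<open>Pair each character with the one dual to \<open>g j\<close>. By invariance the result,
  which is the value at \<open>g j\<close>, can be computed after composing with
  \<open>\<phi>\<close>, where it depends only on the values at the elements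
  \<open>\<phi> (g j)\<close>. So no information about these characters is lost under
  \<open>\<phi>\<close>.\<close>

lemma square_word_test:
  assumes L: "group L" and fam: "free_family L I g" and js: "set js \<subseteq> I" "distinct js"
    and \<phi>: "\<phi> \<in> hom L L" "\<phi> (eval_word L g (square_word js)) = eval_word L g (square_word js)"
    and \<chi>: "\<chi> \<in> hom L xor_group" "\<chi>' \<in> hom L xor_group"
    and eq: "\<And>j. j \<in> set js \<Longrightarrow> \<chi> (\<phi> (g j)) = \<chi>' (\<phi> (g j))" and j: "j \<in> set js"
  shows "\<chi> (g j) = \<chi>' (g j)"
proof -
  interpret L: group L by (rule L)
  obtain \<beta> where \<beta>: "\<beta> \<in> hom L xor_group" "\<And>i. i \<in> I \<Longrightarrow> \<beta> (g i) = (i = j)"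
    using L.free_family_extend[OF fam group_xor_group, of "\<lambda>i. i = j"]
    by (auto simp: xor_group_def)
  have dual: "parity_form js (\<psi> \<circ> g) (\<beta> \<circ> g) = \<psi> (g j)" for \<psi> :: "'a \<Rightarrow> bool"
  proof -
    have "parity_form js (\<psi> \<circ> g) (\<beta> \<circ> g) = parity_form js (\<psi> \<circ> g) (\<lambda>i. i = j)"
      by (rule parity_form_cong) (use \<beta>(2) js(1) in auto)
    then show ?thesis using parity_form_dual[OF js(2)] j by simp
  qed
  have "parity_form js (\<chi> \<circ> \<phi> \<circ> g) (\<beta> \<circ> \<phi> \<circ> g) = parity_form js (\<chi>' \<circ> \<phi> \<circ> g) (\<beta> \<circ> \<phi> \<circ> g)"
    by (rule parity_form_cong) (use eq in auto)
  then show ?thesis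
    using parity_form_invariant[OF L fam js(1) \<phi> \<chi>(1) \<beta>(1)]
      parity_form_invariant[OF L fam js(1) \<phi> \<chi>(2) \<beta>(1)] dual by simp
qed

text \<open>Count characters. Each subset of \<open>set js\<close> is the support there of a
  character of \<open>L\<close>, whose pullback to \<open>M\<close> is coded by a subset of
  \<open>C\<close>. Equal pullbacks agree on the image of \<open>\<phi>\<close>, hence on
  \<open>js\<close> by \<open>square_word_test\<close>. Here \<open>js\<close> is a finite part of
  the basis, so that the bound applies before finiteness of the basis is known.\<close>

lemma rank_le_of_square_word_fixed:
  assumes L: "group L" and fam: "free_family L I g" and js: "set js \<subseteq> I" "distinct js"
    and \<phi>: "\<phi> \<in> hom L L" "\<phi> (eval_word L g (square_word js)) = eval_word L g (square_word js)"
    and M: "group M" "free_family M C b" "finite C"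
    and \<alpha>: "\<alpha> \<in> hom M L" "\<phi> ` carrier L \<subseteq> \<alpha> ` carrier M"
  shows "length js \<le> card C"
proof -
  interpret L: group L by (rule L)
  have "\<exists>\<chi> \<in> hom L xor_group. \<forall>i \<in> I. \<chi> (g i) = (i \<in> J)" for J
    by (rule L.free_family_extend[OF fam group_xor_group]) (simp add: xor_group_def)
  then obtain \<chi> where \<chi>: "\<And>J. \<chi> J \<in> hom L xor_group" "\<And>J i. i \<in> I \<Longrightarrow> \<chi> J (g i) = (i \<in> J)"
    by metis
  define T where "T J = {c \<in> C. \<chi> J (\<alpha> (b c))}" for J
  have "inj_on T (Pow (set js))"
  proof (rule inj_onI)
    fix J J' assume J: "J \<in> Pow (set js)" "J' \<in> Pow (set js)" "T J = T J'"
    have \<alpha>_eq: "(\<chi> J \<circ> \<alpha>) y = (\<chi> J' \<circ> \<alpha>) y" if "y \<in> carrier M" for y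
    proof (rule free_family_hom_eq[OF M(2,1) group_xor_group _ _ _ that])
      show "\<chi> J \<circ> \<alpha> \<in> hom M xor_group" "\<chi> J' \<circ> \<alpha> \<in> hom M xor_group"
        by (rule Group.hom_compose[OF \<alpha>(1) \<chi>(1)])+
      show "(\<chi> J \<circ> \<alpha>) (b c) = (\<chi> J' \<circ> \<alpha>) (b c)" if "c \<in> C" for c
        using J(3) that by (auto simp: T_def)
    qed
    have \<phi>_eq: "\<chi> J (\<phi> (g j)) = \<chi> J' (\<phi> (g j))" if j: "j \<in> set js" for j
    proof -
      have "g j \<in> carrier L" using j js(1) free_family_mem[OF fam] by blast
      then obtain y where "y \<in> carrier M" "\<phi> (g j) = \<alpha> y" using \<alpha>(2) by blast
      then show ?thesis using \<alpha>_eq by simp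
    qed
    have "j \<in> J \<longleftrightarrow> j \<in> J'" if j: "j \<in> set js" for j
      using square_word_test[OF L fam js \<phi> \<chi>(1)[of J] \<chi>(1)[of J'] \<phi>_eq j]
        \<chi>(2)[of j J] \<chi>(2)[of j J'] j js(1) by auto
    then show "J = J'" using J(1,2) by blast
  qed
  then have "card (Pow (set js)) \<le> card (Pow C)"
    by (rule card_inj_on_le) (use M(3) in \<open>auto simp: T_def\<close>)
  then show ?thesis
    using M(3) by (simp add: card_Pow distinct_card[OF js(2)])
qed

text \<open>The image of \<open>\<phi>\<close> has at least as many basis elements as
  \<open>L\<close>, so some \<open>\<tau>\<close> maps it onto \<open>L\<close>. Then
  \<open>\<tau> \<circ> \<phi>\<close> is a surjective endomorphism, injective by the Hopf property,
  and \<open>\<phi>\<close> is injective with it.\<close>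

lemma inj_of_square_word_fixed:
  assumes L: "group L" and fam: "free_family L (set js) g" and js: "distinct js"
    and \<phi>: "\<phi> \<in> hom L L" "\<phi> (eval_word L g (square_word js)) = eval_word L g (square_word js)"
    and C: "free_family (L\<lparr>carrier := \<phi> ` carrier L\<rparr>) C b"
  shows "inj_on \<phi> (carrier L)"
proof -
  interpret L: group L by (rule L)
  interpret \<phi>: group_hom L L \<phi> using L \<phi>(1) by (simp add: group_hom_def group_hom_axioms_def)
  let ?M = "L\<lparr>carrier := \<phi> ` carrier L\<rparr>"
  have sub: "subgroup (\<phi> ` carrier L) L" by (rule \<phi>.img_is_subgroup)
  interpret M: group ?M by (rule L.subgroup_imp_group[OF sub])
  have incl: "(\<lambda>x. x) \<in> hom ?M L" using subgroup.subset[OF sub] by (auto simp: hom_def)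
  have le: "finite C \<Longrightarrow> length js \<le> card C"
    using rank_le_of_square_word_fixed[OF L fam order_refl js \<phi> M.is_group C _ incl] by simp
  \<comment> \<open>Matches the basis of \<open>L\<close> with part of the basis \<open>C\<close> of
    the image, which may a priori be infinite.\<close>
  obtain e where e: "e ` set js \<subseteq> C" "inj_on e (set js)"
  proof (cases "finite C")
    case True
    then show thesis using that card_le_inj[of "set js" C] le distinct_card[OF js] by auto
  next
    case False
    then obtain C' where "C' \<subseteq> C" "finite C'" "card C' = length js"
      using infinite_arbitrarily_large by metis
    then show thesis using that card_le_inj[of "set js" C'] distinct_card[OF js] by auto
  qed
  \<comment> \<open>Unmatched elements of \<open>C\<close> are sent to the identity; surjectivity of
    \<open>\<tau>\<close> comes from the matched ones alone.\<close>
  define f where "f c = (if c \<in> e ` set js then g (inv_into (set js) e c) else \<one>\<^bsub>L\<^esub>)" for c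
  have "f \<in> C \<rightarrow> carrier L"
    using free_family_mem[OF fam] by (auto simp: f_def inv_into_into)
  then obtain \<tau> where \<tau>: "\<tau> \<in> hom ?M L" "\<And>c. c \<in> C \<Longrightarrow> \<tau> (b c) = f c"
    using M.free_family_extend[OF C L] by blast
  interpret \<tau>: group_hom ?M L \<tau>
    using M.is_group L \<tau>(1) by (simp add: group_hom_def group_hom_axioms_def)
  have \<tau>_gen: "\<tau> (b (e j)) = g j" if "j \<in> set js" for j
    using that e \<tau>(2)[of "e j"] by (auto simp: f_def)
  have comp: "\<tau> \<circ> \<phi> \<in> hom L L"
    using \<tau>(1) \<phi>(1) by (auto simp: hom_def)
  have "x \<in> (\<tau> \<circ> \<phi>) ` carrier L" if x: "x \<in> carrier L" for x
  proof -
    obtain w where w: "fst ` set w \<subseteq> set js" "x = eval_word L g w"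
      using free_familyE[OF fam x] .
    have be: "(b \<circ> e) ` fst ` set w \<subseteq> carrier ?M"
      using w(1) e(1) free_family_mem[OF C] by fastforce
    have "\<tau> (eval_word ?M (b \<circ> e) w) = eval_word L (\<tau> \<circ> (b \<circ> e)) w"
      by (rule \<tau>.hom_eval_word[OF be])
    also have "\<dots> = x" unfolding w(2) by (rule eval_word_cong) (use w(1) \<tau>_gen in auto)
    finally have "\<tau> (eval_word ?M (b \<circ> e) w) = x" .
    moreover have "eval_word ?M (b \<circ> e) w \<in> \<phi> ` carrier L"
      using M.eval_word_closed[OF be] by simp
    ultimately show ?thesis by (auto simp: image_comp[symmetric])
  qed
  then have "(\<tau> \<circ> \<phi>) ` carrier L = carrier L"
    using hom_in_carrier[OF comp] by blast
  from free_family_hopfian[OF L fam _ comp this] have "inj_on (\<tau> \<circ> \<phi>) (carrier L)" by simp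
  then show ?thesis by (rule inj_on_imageI2)
qed

text \<open>Otherwise the endomorphism killing the missing generator would fix the product of squares.\<close>

lemma square_word_uses_every_generator:
  assumes M: "group M" and fam: "free_family M (set js) g" and js: "distinct js"
    and C: "free_family M C b" and w: "fst ` set w \<subseteq> C"
      "eval_word M b w = eval_word M g (square_word js)"
  shows "C \<subseteq> fst ` set w"
proof
  fix c0 assume c0: "c0 \<in> C"
  interpret M: group M by (rule M)
  show "c0 \<in> fst ` set w"
  proof (rule ccontr)
    assume notin: "c0 \<notin> fst ` set w"
    have "(\<lambda>c. if c = c0 then \<one>\<^bsub>M\<^esub> else b c) \<in> C \<rightarrow> carrier M"
      using free_family_mem[OF C] by auto
    then obtain \<sigma> where \<sigma>: "\<sigma> \<in> hom M M" "\<And>c. c \<in> C \<Longrightarrow> \<sigma> (b c) = (if c = c0 then \<one>\<^bsub>M\<^esub> else b c)"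
      using M.free_family_extend[OF C M] by blast
    \<comment> \<open>\<open>\<chi>\<close> detects exactly the generator that
      \<open>\<sigma>\<close> kills, so it vanishes after \<open>\<sigma>\<close>. Comparison with
      the zero character then makes \<open>\<chi>\<close> vanish on the basis \<open>g\<close>,
      against its value at \<open>b c0\<close>.\<close>
    obtain \<chi> where \<chi>: "\<chi> \<in> hom M xor_group" "\<And>c. c \<in> C \<Longrightarrow> \<chi> (b c) = (c = c0)"
      using M.free_family_extend[OF C group_xor_group, of "\<lambda>c. c = c0"]
      by (auto simp: xor_group_def)
    have id: "(\<lambda>x. x) \<in> hom M M" by (auto simp: hom_def)
    have triv: "(\<lambda>_. False) \<in> hom M xor_group" by (auto simp: hom_def xor_group_def)
    have \<chi>_one: "\<chi> \<one>\<^bsub>M\<^esub> = False"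
      using hom_one[OF \<chi>(1) M group_xor_group] by (simp add: xor_group_def)
    have bw: "b ` fst ` set w \<subseteq> carrier M" using w(1) free_family_mem[OF C] by blast
    have "\<sigma> (eval_word M b w) = eval_word M b w"
    proof (rule hom_eq_on_words[OF M M \<sigma>(1) id bw])
      fix c assume "c \<in> fst ` set w"
      then have "c \<in> C" "c \<noteq> c0" using w(1) notin by blast+
      then show "\<sigma> (b c) = b c" using \<sigma>(2) by simp
    qed
    then have fixed: "\<sigma> (eval_word M g (square_word js)) = eval_word M g (square_word js)"
      by (simp add: w(2))
    have "\<chi> (\<sigma> x) = False" if "x \<in> carrier M" for x
    proof -
      have "(\<chi> \<circ> \<sigma>) x = (\<lambda>_. False) x"
        by (rule free_family_hom_eq[OF C M group_xor_group Group.hom_compose[OF \<sigma>(1) \<chi>(1)] triv _ that])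
          (simp add: \<sigma>(2) \<chi>(2) \<chi>_one)
      then show ?thesis by simp
    qed
    then have "\<chi> (\<sigma> (g j)) = False" if "j \<in> set js" for j
      using that free_family_mem[OF fam] by blast
    then have "\<chi> (g j) = False" if "j \<in> set js" for j
      using square_word_test[OF M fam order_refl js \<sigma>(1) fixed \<chi>(1) triv _ that] by blast
    then have "\<chi> x = (\<lambda>_. False) x" if "x \<in> carrier M" for x
      by (intro free_family_hom_eq[OF fam M group_xor_group \<chi>(1) triv _ that])
    then show False using \<chi>(2)[OF c0] free_family_mem[OF C c0] by simp
  qed
qed

section \<open>Verbally closed subgroups\<close>

text \<open>Transport of the subgroup basis from reduced words to \<open>G\<close>.
  \<open>len\<close> is word length in the basis \<open>g\<close>; finiteness of \<open>S\<close>
  makes its balls finite.\<close>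

lemma (in group) free_subgroup_basis:
  fixes S :: "'s set"
  assumes fam: "free_family G S g" and "finite S"
  shows "\<exists>len :: 'a \<Rightarrow> nat. (\<forall>n. finite {x \<in> carrier G. len x \<le> n}) \<and>
    (\<forall>K. subgroup K G \<longrightarrow> (\<exists>C (b :: 's letter list \<Rightarrow> 'a). free_family (G\<lparr>carrier := K\<rparr>) C b \<and>
      (\<forall>k \<in> K. \<exists>w. fst ` set w \<subseteq> {c \<in> C. len (b c) \<le> len k} \<and> eval_word G b w = k)))"
proof -
  let ?F = "free_group S"
  interpret F: group ?F by (rule group_free_group)
  define e where "e = eval_word G g"
  have e: "e \<in> iso ?F G" using fam by (simp add: free_family_def e_def)
  define e' where "e' = inv_into (carrier ?F) e"
  have e': "e' \<in> iso G ?F" unfolding e'_def by (rule F.iso_set_sym[OF e])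
  have ee': "e (e' x) = x" if "x \<in> carrier G" for x
    using e that by (simp add: e'_def f_inv_into_f iso_iff del: free_group_simps)
  have e'e: "e' (e x) = x" if "x \<in> carrier ?F" for x
    using e that by (simp add: e'_def inv_into_f_f iso_iff del: free_group_simps)
  interpret e: group_hom ?F G e
    using e by (simp add: group_hom_def group_hom_axioms_def F.is_group iso_iff)
  interpret e': group_hom G ?F e'
    using e' by (simp add: group_hom_def group_hom_axioms_def F.is_group iso_iff)
  define len where "len x = length (e' x)" for x
  show ?thesis
  proof (intro exI[of _ len] conjI allI impI)
    fix n
    have "e' ` {x \<in> carrier G. len x \<le> n} \<subseteq> {w. set w \<subseteq> S \<times> UNIV \<and> length w \<le> n}"
      using e'.hom_closed by (fastforce simp: len_def)
    moreover have "finite {w. set w \<subseteq> S \<times> (UNIV :: bool set) \<and> length w \<le> n}"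
      using \<open>finite S\<close> by (intro finite_lists_length_le) simp
    moreover have "inj_on e' {x \<in> carrier G. len x \<le> n}"
      using ee' by (intro inj_on_inverseI[of _ e]) simp
    ultimately show "finite {x \<in> carrier G. len x \<le> n}"
      using inj_on_finite by blast
  next
    fix K assume K: "subgroup K G"
    have KG: "K \<subseteq> carrier G" by (rule subgroup.subset[OF K])
    have K': "subgroup (e' ` K) ?F" by (rule e'.subgroup_img_is_subgroup[OF K])
    have K'F: "e' ` K \<subseteq> carrier ?F" by (rule subgroup.subset[OF K'])
    let ?M = "?F\<lparr>carrier := e' ` K\<rparr>"
    have M: "group ?M" by (rule F.subgroup_imp_group[OF K'])
    obtain C where C: "free_family ?M C (\<lambda>b. b)"
      "\<And>k. k \<in> e' ` K \<Longrightarrow> \<exists>w \<in> carrier (free_group {b \<in> C. length b \<le> length k}).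
        eval_word ?M (\<lambda>b. b) w = k"
      using subgroup_free_group_basis[OF K'] by blast
    have eM: "e \<in> hom ?M G"
      using e.homh K'F by (auto simp: hom_def Pi_iff subset_iff simp del: free_group_simps)
    interpret eM: group_hom ?M G e
      using eM M by (simp add: group_hom_def group_hom_axioms_def)
    have "inj_on e (carrier ?M)"
      using K'F by (intro inj_on_inverseI[of _ e'] e'e) (simp add: subset_iff del: free_group_simps)
    moreover have "e ` carrier ?M = K"
    proof -
      have "(\<lambda>x. e (e' x)) ` K = (\<lambda>x. x) ` K" by (rule image_cong) (use ee' KG in blast)+
      then show ?thesis by (simp add: image_image)
    qed
    ultimately have 1: "free_family (G\<lparr>carrier := K\<rparr>) C e"
      using free_family_image[OF C(1) M is_group eM] by (simp add: comp_def)
    have 2: "\<exists>w. fst ` set w \<subseteq> {c \<in> C. len (e c) \<le> len k} \<and> eval_word G e w = k" if k: "k \<in> K" for k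
    proof -
      obtain w where w: "fst ` set w \<subseteq> {b \<in> C. length b \<le> length (e' k)}"
        "eval_word ?M (\<lambda>b. b) w = e' k"
        using C(2)[of "e' k"] k by auto
      have CF: "c \<in> carrier ?M" if "c \<in> C" for c using free_family_mem[OF C(1) that] .
      have "(\<lambda>b. b) ` fst ` set w \<subseteq> carrier ?M" using w(1) CF by blast
      from eM.hom_eval_word[OF this] have "eval_word G e w = k"
        using w(2) ee' k KG by (auto simp: comp_def)
      moreover have "len (e c) = length c" if "c \<in> C" for c
        using CF[OF that] e'e K'F by (auto simp: len_def)
      ultimately have "eval_word G e w = k \<and> fst ` set w \<subseteq> {c \<in> C. len (e c) \<le> len k}"
        using w(1) unfolding len_def[of k] by fastforce
      then show ?thesis by blast
    qed
    show "\<exists>C (b :: 's letter list \<Rightarrow> 'a). free_family (G\<lparr>carrier := K\<rparr>) C b \<and>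
      (\<forall>k \<in> K. \<exists>w. fst ` set w \<subseteq> {c \<in> C. len (b c) \<le> len k} \<and> eval_word G b w = k)"
      using 1 2 by blast
  qed
qed

text \<open>Express \<open>v\<close> by a word in the basis of \<open>G\<close> and read the basis
  elements as variables. The basis itself solves the resulting equation in \<open>G\<close>; a
  solution in \<open>H\<close> serves as the list of images of the basis under
  \<open>\<phi>\<close>.\<close>

lemma (in group) verbally_closed_hom:
  assumes fam: "free_family G S s" and "finite S" and H: "subgroup H G"
    and vc: "verbally_closed_subgroup H G" and v: "v \<in> H"
  obtains \<phi> where "\<phi> \<in> hom G (G\<lparr>carrier := H\<rparr>)" "\<phi> v = v"
proof -
  define n where "n = card S"
  obtain e where e: "bij_betw e {1..n} S"
    using ex_bij_betw_nat_finite_1[OF \<open>finite S\<close>] unfolding n_def by blast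
  have eS: "e i \<in> S" if "i \<in> {1..n}" for i using e that by (auto simp: bij_betw_def)
  have f: "s \<circ> e \<in> {1..n} \<rightarrow> carrier G" using eS free_family_mem[OF fam] by auto
  interpret f: group_hom "free_group {1..n}" G "eval_word G (s \<circ> e)"
    using eval_word_hom[OF f] by (simp add: group_hom_def group_hom_axioms_def group_free_group)
  have vG: "v \<in> carrier G" using v subgroup.subset[OF H] by blast
  obtain u where u: "fst ` set u \<subseteq> S" "v = eval_word G s u"
    using free_familyE[OF fam vG] .
  \<comment> \<open>A word for \<open>v\<close> in numbered variables arises without renaming
    letters: the values of such words form a subgroup, and it contains the basis.\<close>
  have "s x \<in> eval_word G (s \<circ> e) ` carrier (free_group {1..n})" if "x \<in> S" for x
  proof -
    obtain i where i: "i \<in> {1..n}" "x = e i" using e \<open>x \<in> S\<close> by (auto simp: bij_betw_def)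
    have "eval_word G (s \<circ> e) [(i, True)] = s x"
      using i free_family_mem[OF fam that] by (simp add: eval_letter_def)
    then show ?thesis using i by (intro image_eqI[of _ _ "[(i, True)]"]) simp_all
  qed
  then have "s ` fst ` set u \<subseteq> eval_word G (s \<circ> e) ` carrier (free_group {1..n})"
    using u(1) by blast
  then have "v \<in> eval_word G (s \<circ> e) ` carrier (free_group {1..n})"
    unfolding u(2) by (rule eval_word_in_subgroup[OF f.img_is_subgroup])
  then obtain w where w: "w \<in> carrier (free_group {1..n})" "eval_word G (s \<circ> e) w = v" by blast
  then obtain y where y: "y \<in> {1..n} \<rightarrow> H" "eval_word G y w = v"
    using vc v f unfolding verbally_closed_subgroup_def by blast
  have GH: "group (G\<lparr>carrier := H\<rparr>)" by (rule subgroup_imp_group[OF H])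
  have "y \<circ> inv_into {1..n} e \<in> S \<rightarrow> carrier (G\<lparr>carrier := H\<rparr>)"
    using y(1) e by (auto simp: bij_betw_def inv_into_into Pi_iff)
  then obtain \<phi> where \<phi>: "\<phi> \<in> hom G (G\<lparr>carrier := H\<rparr>)"
    "\<And>x. x \<in> S \<Longrightarrow> \<phi> (s x) = (y \<circ> inv_into {1..n} e) x"
    using free_family_extend[OF fam GH] by blast
  interpret \<phi>: group_hom G "G\<lparr>carrier := H\<rparr>" \<phi>
    using \<phi>(1) GH by (simp add: group_hom_def group_hom_axioms_def)
  have wn: "fst ` set w \<subseteq> {1..n}" using w(1) by simp
  have "\<phi> v = eval_word (G\<lparr>carrier := H\<rparr>) (\<phi> \<circ> (s \<circ> e)) w"
    unfolding w(2)[symmetric] by (rule \<phi>.hom_eval_word) (use wn f in blast)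
  also have "\<dots> = eval_word (G\<lparr>carrier := H\<rparr>) y w"
  proof (rule eval_word_cong)
    fix i assume "i \<in> fst ` set w"
    then have i: "i \<in> {1..n}" using wn by blast
    then have "inv_into {1..n} e (e i) = i" using e by (auto simp: bij_betw_def)
    then show "(\<phi> \<circ> (s \<circ> e)) i = y i" using \<phi>(2)[OF eS[OF i]] by simp
  qed
  also have "\<dots> = v" using eval_word_subgroup[OF H, of y w] y wn by blast
  finally show thesis using that \<phi>(1) by blast
qed

lemma (in group) surj_of_square_word_fixed:
  fixes S :: "'s set"
  assumes fam: "free_family G S s" "finite S" and H: "subgroup H G"
    and g: "free_family (G\<lparr>carrier := H\<rparr>) (set js) g" and js: "distinct js"
    and \<psi>: "\<psi> \<in> hom (G\<lparr>carrier := H\<rparr>) (G\<lparr>carrier := H\<rparr>)" "inj_on \<psi> H"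
    and v: "v = eval_word (G\<lparr>carrier := H\<rparr>) g (square_word js)" "\<psi> v = v"
  shows "\<psi> ` H = H"
proof -
  obtain len :: "'a \<Rightarrow> nat" where len: "\<forall>n. finite {x \<in> carrier G. len x \<le> n}"
    "\<forall>K. subgroup K G \<longrightarrow> (\<exists>C (b :: 's letter list \<Rightarrow> 'a). free_family (G\<lparr>carrier := K\<rparr>) C b \<and>
      (\<forall>k \<in> K. \<exists>w. fst ` set w \<subseteq> {c \<in> C. len (b c) \<le> len k} \<and> eval_word G b w = k))"
    using free_subgroup_basis[OF fam] by blast
  let ?L = "G\<lparr>carrier := H\<rparr>"
  have L: "group ?L" by (rule subgroup_imp_group[OF H])
  have HG: "H \<subseteq> carrier G" by (rule subgroup.subset[OF H])
  have \<psi>H: "\<psi> x \<in> H" if "x \<in> H" for x using hom_in_carrier[OF \<psi>(1)] that by simp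
  have powL: "\<psi> ^^ k \<in> hom ?L ?L" for k
  proof (induction k)
    case 0
    then show ?case by (simp add: hom_def)
  next
    case (Suc k)
    show ?case using Group.hom_compose[OF Suc \<psi>(1)] by (simp add: comp_def)
  qed
  have pow_inj: "inj_on (\<psi> ^^ k) H" for k
  proof (induction k)
    case (Suc k)
    have "(\<psi> ^^ k) ` H \<subseteq> H" using hom_carrier[OF powL] by simp
    then have "inj_on \<psi> ((\<psi> ^^ k) ` H)" using \<psi>(2) inj_on_subset by blast
    then show ?case using comp_inj_on[OF Suc] by (simp add: comp_def)
  qed simp
  have powH: "(\<psi> ^^ k) x \<in> H" if "x \<in> H" for k x
    using hom_in_carrier[OF powL] that by simp
  have pow_v: "(\<psi> ^^ k) v = v" for k by (induction k) (simp_all add: v(2))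
  have gH: "g ` fst ` set (square_word js) \<subseteq> carrier ?L"
    using free_family_mem[OF g] by auto
  have vH: "v \<in> H"
    using group.eval_word_closed[OF L gH] by (simp add: v(1))
  define K where "K k = (\<psi> ^^ k) ` H" for k
  have powG: "\<psi> ^^ k \<in> hom ?L G" for k
    using powL[of k] HG by (auto simp: hom_def)
  have subK: "subgroup (K k) G" for k
  proof -
    interpret h: group_hom ?L G "\<psi> ^^ k"
      using powG L by (simp add: group_hom_def group_hom_axioms_def)
    show ?thesis using h.img_is_subgroup by (simp add: K_def)
  qed
  define short where "short = {x \<in> carrier G. len x \<le> len v}"
  \<comment> \<open>Since \<open>v\<close> is fixed, it is the product of squares of the transported
    basis of \<open>K i\<close>, and it needs every element of the basis \<open>C\<close> obtained
    from \<open>free_subgroup_basis\<close>. All of these are then no longer than \<open>v\<close>,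
    so \<open>K i\<close> is generated by its short elements.\<close>
  have incl: "K i \<subseteq> K j" if "K i \<inter> short \<subseteq> K j" for i j
  proof
    fix x assume x: "x \<in> K i"
    let ?M = "G\<lparr>carrier := K i\<rparr>"
    have M: "group ?M" by (rule subgroup_imp_group[OF subK])
    obtain C and b :: "'s letter list \<Rightarrow> 'a" where C: "free_family ?M C b"
      "\<And>k. k \<in> K i \<Longrightarrow> \<exists>w. fst ` set w \<subseteq> {c \<in> C. len (b c) \<le> len k} \<and> eval_word G b w = k"
      using len(2)[rule_format, OF subK[of i]] by blast
    have bK: "b ` fst ` set w \<subseteq> K i" if "fst ` set w \<subseteq> C" for w :: "'s letter list letter list"
      using free_family_mem[OF C(1)] that by auto
    have famK: "free_family ?M (set js) ((\<psi> ^^ i) \<circ> g)"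
      using free_family_image[OF g L is_group powG, of i] pow_inj by (simp add: K_def)
    interpret h: group_hom ?L G "\<psi> ^^ i"
      using powG L by (simp add: group_hom_def group_hom_axioms_def)
    have v_eq: "eval_word ?M ((\<psi> ^^ i) \<circ> g) (square_word js) = v"
    proof -
      have "((\<psi> ^^ i) \<circ> g) ` fst ` set (square_word js) \<subseteq> K i"
        using gH by (auto simp: K_def)
      from eval_word_subgroup[OF subK this]
      have "eval_word ?M ((\<psi> ^^ i) \<circ> g) (square_word js) = (\<psi> ^^ i) v"
        using h.hom_eval_word[OF gH] v(1) by simp
      then show ?thesis by (simp add: pow_v)
    qed
    have "v \<in> K i" using pow_v[of i] vH unfolding K_def by (metis imageI)
    then obtain w where w: "fst ` set w \<subseteq> {c \<in> C. len (b c) \<le> len v}" "eval_word G b w = v"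
      using C(2) by blast
    have wC: "fst ` set w \<subseteq> C" using w(1) by blast
    have "eval_word ?M b w = eval_word ?M ((\<psi> ^^ i) \<circ> g) (square_word js)"
      using eval_word_subgroup[OF subK bK[OF wC]] w(2) v_eq by simp
    from square_word_uses_every_generator[OF M famK js C(1) wC this]
    have "C \<subseteq> {c \<in> C. len (b c) \<le> len v}" using w(1) by blast
    moreover have "b c \<in> K i" if "c \<in> C" for c using free_family_mem[OF C(1) that] by simp
    ultimately have "b ` C \<subseteq> K i \<inter> short"
      using subgroup.subset[OF subK[of i]] unfolding short_def by blast
    then have bC: "b ` C \<subseteq> K j" using that by blast
    obtain u where "fst ` set u \<subseteq> C" "eval_word G b u = x" using C(2)[OF x] by blast
    then show "x \<in> K j" using eval_word_in_subgroup[OF subK, of b u j] bC by blast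
  qed
  have "finite (range (\<lambda>k. K k \<inter> short))"
  proof (rule finite_subset)
    show "range (\<lambda>k. K k \<inter> short) \<subseteq> Pow short" by blast
    show "finite (Pow short)" using len(1) by (simp add: short_def)
  qed
  then have "\<not> inj (\<lambda>k. K k \<inter> short)" using finite_imageD infinite_UNIV_nat by blast
  then obtain i j where ij: "i < j" "K i \<inter> short = K j \<inter> short"
    unfolding inj_on_def by (metis nat_neq_iff)
  \<comment> \<open>The images decrease as the exponent grows, so for \<open>i < j\<close> this is
    the informative inclusion. Cancelling the injective \<open>\<psi> ^^ i\<close> leaves a positive
    power of \<open>\<psi>\<close> that maps onto \<open>H\<close>.\<close>
  then have Kij: "K i \<subseteq> K j" by (intro incl) blast
  show ?thesis
  proof (intro equalityI subsetI)
    fix x assume x: "x \<in> H"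
    obtain y where y: "y \<in> H" "(\<psi> ^^ i) x = (\<psi> ^^ j) y" using Kij x by (auto simp: K_def)
    have "(\<psi> ^^ j) y = (\<psi> ^^ i) ((\<psi> ^^ (j - i)) y)"
      using ij(1) funpow_add[of i "j - i" \<psi>] by simp
    then have "x = (\<psi> ^^ (j - i)) y"
      using inj_onD[OF pow_inj[of i]] y x powH by metis
    also have "\<dots> = \<psi> ((\<psi> ^^ (j - i - 1)) y)"
      using ij(1) by (metis Suc_diff_1 funpow.simps(2) o_apply zero_less_diff)
    finally show "x \<in> \<psi> ` H" using powH[OF y(1)] by blast
  qed (use \<psi>H in blast)
qed

lemma (in group) verbally_closed_imp_retract:
  fixes S :: "'s set"
  assumes fam: "free_family G S s" "finite S" and H: "subgroup H G"
    and vc: "verbally_closed_subgroup H G"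
  shows "retract_subgroup H G"
proof -
  let ?L = "G\<lparr>carrier := H\<rparr>"
  have L: "group ?L" by (rule subgroup_imp_group[OF H])
  have HG: "H \<subseteq> carrier G" by (rule subgroup.subset[OF H])
  have basis: "\<exists>C (b :: 's letter list \<Rightarrow> 'a). free_family (G\<lparr>carrier := K\<rparr>) C b" if "subgroup K G" for K
    using free_subgroup_basis[OF fam] that by blast
  obtain I and g :: "'s letter list \<Rightarrow> 'a" where g: "free_family ?L I g" using basis[OF H] by blast
  have endo: "\<exists>\<phi>. \<phi> \<in> hom G ?L \<and> \<phi> (eval_word ?L g (square_word js)) = eval_word ?L g (square_word js)"
    if "set js \<subseteq> I" for js
  proof -
    have "g ` fst ` set (square_word js) \<subseteq> carrier ?L" using that free_family_mem[OF g] by auto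
    from group.eval_word_closed[OF L this] have "eval_word ?L g (square_word js) \<in> H" by simp
    then show ?thesis using verbally_closed_hom[OF fam H vc] by metis
  qed
  have restr: "\<phi> \<in> hom ?L ?L" if "\<phi> \<in> hom G ?L" for \<phi> using that HG by (auto simp: hom_def)
  \<comment> \<open>\<open>I\<close> may still be infinite here. The rank is compared with that of
    \<open>G\<close> itself, taking \<open>\<phi>\<close> for the map onto its own image.\<close>
  have bound: "length js \<le> card S" if js: "set js \<subseteq> I" "distinct js" for js
  proof -
    obtain \<phi> where \<phi>: "\<phi> \<in> hom G ?L"
      "\<phi> (eval_word ?L g (square_word js)) = eval_word ?L g (square_word js)"
      using endo[OF js(1)] by blast
    show ?thesis
      using HG by (intro rank_le_of_square_word_fixed[OF L g js restr[OF \<phi>(1)] \<phi>(2) is_group fam \<phi>(1)]) auto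
  qed
  have "finite I"
  proof (rule ccontr)
    assume "infinite I"
    then obtain J where J: "J \<subseteq> I" "finite J" "card J = Suc (card S)"
      using infinite_arbitrarily_large by metis
    obtain js where "set js = J" "distinct js" using finite_distinct_list[OF J(2)] by blast
    then show False using bound[of js] J distinct_card[of js] by simp
  qed
  then obtain js where js: "set js = I" "distinct js" using finite_distinct_list by blast
  define v where "v = eval_word ?L g (square_word js)"
  obtain \<phi> where \<phi>: "\<phi> \<in> hom G ?L" "\<phi> v = v" using endo[of js] js by (auto simp: v_def)
  note \<psi> = restr[OF \<phi>(1)]
  interpret \<psi>: group_hom ?L ?L \<phi> using \<psi> L by (simp add: group_hom_def group_hom_axioms_def)
  have "subgroup (\<phi> ` H) ?L" using \<psi>.img_is_subgroup by simp
  then have "subgroup (\<phi> ` H) G" using H incl_subgroup by blast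
  then obtain C and b :: "'s letter list \<Rightarrow> 'a" where "free_family (G\<lparr>carrier := \<phi> ` H\<rparr>) C b"
    using basis by blast
  then have C: "free_family (?L\<lparr>carrier := \<phi> ` carrier ?L\<rparr>) C b" by simp
  have g': "free_family ?L (set js) g" using g js(1) by simp
  have inj: "inj_on \<phi> H"
    using inj_of_square_word_fixed[OF L g' js(2) \<psi> _ C] \<phi>(2) by (simp add: v_def)
  have surj: "\<phi> ` H = H"
    by (rule surj_of_square_word_fixed[OF fam H g' js(2) \<psi> inj v_def \<phi>(2)])
  have iso: "\<phi> \<in> iso ?L ?L" using \<psi> inj surj by (simp add: iso_iff)
  then have inv: "inv_into H \<phi> \<in> hom ?L ?L"
    using group.iso_set_sym[OF L iso] by (simp add: iso_iff)
  \<comment> \<open>\<open>\<phi>\<close> restricts to an automorphism of \<open>H\<close>;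
    following it by the inverse automorphism makes it the identity on \<open>H\<close>.\<close>
  have "inv_into H \<phi> \<circ> \<phi> \<in> hom G ?L" by (rule Group.hom_compose[OF \<phi>(1) inv])
  moreover have "\<forall>h\<in>H. (inv_into H \<phi> \<circ> \<phi>) h = h" using inj by simp
  ultimately show ?thesis unfolding retract_subgroup_def by blast
qed

section \<open>The equivalences\<close>

text \<open>A retraction fixes the constants and commutes with evaluation, so it turns a solution in
  \<open>G\<close> into one in \<open>H\<close>.\<close>

lemma (in group) retract_imp_algebraically_closed:
  assumes H: "subgroup H G" and "retract_subgroup H G"
  shows "algebraically_closed_subgroup H G"
  unfolding algebraically_closed_subgroup_def
proof (intro allI impI)
  fix n \<E>
  assume \<E>: "\<E> \<subseteq> group_equations n H G"
    and "\<exists>g\<in>{1..n} \<rightarrow> carrier G. \<forall>E\<in>\<E>. solves_equation G g E"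
  then obtain g where g: "g \<in> {1..n} \<rightarrow> carrier G" "\<And>E. E \<in> \<E> \<Longrightarrow> solves_equation G g E" by blast
  obtain \<phi> where \<phi>: "\<phi> \<in> hom G (G\<lparr>carrier := H\<rparr>)" "\<And>h. h \<in> H \<Longrightarrow> \<phi> h = h"
    using assms(2) unfolding retract_subgroup_def by blast
  have HG: "H \<subseteq> carrier G" by (rule subgroup.subset[OF H])
  have \<phi>G: "\<phi> \<in> hom G G" using \<phi>(1) HG by (auto simp: hom_def)
  interpret \<phi>: group_hom G G \<phi> using \<phi>G by (simp add: group_hom_def group_hom_axioms_def is_group)
  define y where "y = \<phi> \<circ> g"
  have step: "eval_free_product G f h (l # E) = case_sum f h l \<otimes> eval_free_product G f h E"
    for f h l and E :: "(nat letter list + 'a) list"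
    by (simp add: eval_free_product_def)
  have ev: "eval_free_product G (eval_word G y) (\<lambda>h. h) E =
      \<phi> (eval_free_product G (eval_word G g) (\<lambda>h. h) E) \<and>
      eval_free_product G (eval_word G g) (\<lambda>h. h) E \<in> carrier G"
    if "set E \<subseteq> carrier (free_group {1..n}) <+> H" for E
    using that
  proof (induction E)
    case Nil
    then show ?case by (simp add: eval_free_product_def)
  next
    case (Cons l E)
    have "case_sum (eval_word G y) (\<lambda>h. h) l = \<phi> (case_sum (eval_word G g) (\<lambda>h. h) l)
        \<and> case_sum (eval_word G g) (\<lambda>h. h) l \<in> carrier G"
    proof (cases l)
      case (Inl w)
      then have "w \<in> carrier (free_group {1..n})" using Cons.prems by (auto simp del: free_group_simps)
      then have "fst ` set w \<subseteq> {1..n}" by simp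
      then have "g ` fst ` set w \<subseteq> carrier G" using g(1) by blast
      then show ?thesis using Inl \<phi>.hom_eval_word[of g w] y_def eval_word_closed[of g w] by simp
    next
      case (Inr h)
      then have "h \<in> H" using Cons.prems by auto
      then show ?thesis using Inr \<phi>(2) HG by auto
    qed
    then show ?case using Cons by (simp add: step)
  qed
  show "\<exists>g\<in>{1..n} \<rightarrow> H. \<forall>E\<in>\<E>. solves_equation G g E"
  proof (intro bexI[of _ y] ballI)
    fix E assume E: "E \<in> \<E>"
    then have "set E \<subseteq> carrier (free_group {1..n}) <+> H"
      using \<E> by (fastforce simp: group_equations_def free_product_def free_product_words_def)
    from ev[OF this] show "solves_equation G y E"
      using g(2)[OF E] by (simp add: solves_equation_def)
  next
    show "y \<in> {1..n} \<rightarrow> H" using g(1) \<phi>(1) by (auto simp: y_def hom_def)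
  qed
qed

text \<open>An equation between a word and a constant is a system of one equation: \<open>w\<close>
  times the inverse of \<open>h\<close> is trivial.\<close>

lemma (in group) algebraically_closed_imp_verbally_closed:
  assumes H: "subgroup H G" and ac: "algebraically_closed_subgroup H G"
  shows "verbally_closed_subgroup H G"
  unfolding verbally_closed_subgroup_def
proof (intro allI ballI iffI)
  fix n :: nat and w h
  assume w: "w \<in> carrier (free_group {1..n})" and h: "h \<in> H"
    and "\<exists>g\<in>{1..n} \<rightarrow> carrier G. eval_word G g w = h"
  then obtain g where g: "g \<in> {1..n} \<rightarrow> carrier G" "eval_word G g w = h" by blast
  have HG: "H \<subseteq> carrier G" by (rule subgroup.subset[OF H])
  have closed: "eval_word G y w \<in> carrier G" if "y \<in> {1..n} \<rightarrow> carrier G" for y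
    using w that by (intro eval_word_closed) auto
  have one: "eval_word G (\<lambda>_. \<one>) u = \<one>" for u :: "nat letter list"
    by (induction u) (auto simp: eval_letter_def)
  show "\<exists>g\<in>{1..n} \<rightarrow> H. eval_word G g w = h"
  \<comment> \<open>The two-syllable expression is a normal form only if both syllables are
    nontrivial. For \<open>h = \<one>\<close> the trivial substitution is a solution; otherwise
    \<open>w\<close> cannot be empty.\<close>
  proof (cases "h = \<one>")
    case True
    then show ?thesis using one subgroup.one_closed[OF H] by (intro bexI[of _ "\<lambda>_. \<one>"]) auto
  next
    case False
    let ?E = "[Inl w, Inr (inv h)]"
    have "w \<noteq> []" using False g(2) by auto
    moreover have "inv h \<in> H" "inv h \<noteq> \<one>"
      using h HG False subgroup.m_inv_closed[OF H h] by auto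
    ultimately have E: "?E \<in> group_equations n H G"
      using w by (auto simp: group_equations_def free_product_def free_product_words_def)
    have solves: "solves_equation G y ?E \<longleftrightarrow> eval_word G y w = h" if "y \<in> {1..n} \<rightarrow> carrier G" for y
      using closed[OF that] h HG inv_solve_right[of \<one> "eval_word G y w" h]
      by (auto simp: solves_equation_def eval_free_product_def)
    have "\<exists>g\<in>{1..n} \<rightarrow> H. \<forall>E\<in>{?E}. solves_equation G g E"
    proof (rule ac[unfolded algebraically_closed_subgroup_def, rule_format])
      show "{?E} \<subseteq> group_equations n H G" "finite {?E}" using E by simp_all
      show "\<exists>g\<in>{1..n} \<rightarrow> carrier G. \<forall>E\<in>{?E}. solves_equation G g E"
        using g solves[OF g(1)] by blast
    qed
    then obtain y where y: "y \<in> {1..n} \<rightarrow> H" "solves_equation G y ?E" by blast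
    then have "y \<in> {1..n} \<rightarrow> carrier G" using HG by blast
    then show ?thesis using y solves by blast
  qed
next
  fix n :: nat and w h
  assume "\<exists>g\<in>{1..n} \<rightarrow> H. eval_word G g w = h"
  then show "\<exists>g\<in>{1..n} \<rightarrow> carrier G. eval_word G g w = h"
    using subgroup.subset[OF H] by blast
qed

theorem theorem1:
  fixes F :: "('a, 'm) monoid_scheme" and H :: "'a set"
  assumes "free_group_of_finite_rank F"
    and "subgroup H F"
  shows "(retract_subgroup H F \<longleftrightarrow> verbally_closed_subgroup H F) \<and>
         (verbally_closed_subgroup H F \<longleftrightarrow> algebraically_closed_subgroup H F)"
proof -
  obtain S where F: "group F" and S: "finite S" "free_family F S (\<lambda>s. s)"
    using assms(1) by (auto simp: free_group_of_finite_rank_def free_basis_iff_free_family)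
  interpret group F by (rule F)
  show ?thesis
    using retract_imp_algebraically_closed[OF assms(2)]
      algebraically_closed_imp_verbally_closed[OF assms(2)]
      verbally_closed_imp_retract[OF S(2,1) assms(2)] by blast
qed

end
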